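(* For every integer $d\ge 5$, there exists a non-degenerate rational curve $X\subset\mathbb{P}^4$ of degree $d$ such that $\dim W_4\le 1$. Thus $$W_4+X\subsetneq W_3=\sigma_3(X)=\mathbb{P}^4.$$
   Context: We work over $\mathbb{C}$; curves are irreducible and projective. For a non-degenerate projective variety $X\subset\mathbb{P}^N$ and a point $p\in\mathbb{P}^N$, the $X$-rank $\mathrm{rk}_X(p)$ is the minimal $r$ such that $p\in\langle p_1,\dots,p_r\rangle$ for some $p_1,\dots,p_r\in X$, where $\langle\cdot\rangle$ denotes projective linear span. Define $W_k=\overline{\{p\in\mathbb{P}^N : \mathrm{rk}_X(p)=k\}}$ (Zariski closure). The $k$-th secant variety is $\sigma_k(X)=\overline{\bigcup_{p_1,\dots,p_k\in X}\langle p_1,\dots,p_k\rangle}$. For closed subsets $W,X\subseteq\mathbb{P}^N$, $W+X$ denotes their join, i.e. the Zariski closure of the union of the lines $\langle w,x\rangle$ with $w\in W$, $x\in X$, $w\neq x$. *)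

theory Defs
  imports "HOL-Analysis.Analysis" "HOL-Library.Poly_Mapping"
begin

section \<open>Complex projective space\<close>

text \<open>
  A point is a line through the origin of the space \<^typ>\<open>complex ^ 'n\<close>, so that
  projective \<open>N\<close>-space is the type \<open>'n proj\<close> with \<open>CARD('n) = N + 1\<close>; in particular
  \<open>5 proj\<close> is projective 4-space and \<open>2 proj\<close> is the projective line.
\<close>

typedef 'n proj = "{vec.span {v} | v :: complex ^ 'n::finite. v \<noteq> 0}"
  morphisms line_of Abs_proj
proof -
  have "(1 :: complex ^ 'n) \<noteq> 0" by simp
  then show ?thesis by blast
qed

definition proj_span :: "'n::finite proj set \<Rightarrow> 'n proj set" where
  "proj_span S = {p. line_of p \<subseteq> vec.span (\<Union>q\<in>S. line_of q)}"

definition nondegenerate :: "'n::finite proj set \<Rightarrow> bool" where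
  "nondegenerate X \<longleftrightarrow> proj_span X = UNIV"

text \<open>The hyperplane whose equation has the coordinates of \<open>h\<close> as coefficients; this
  identifies \<open>'n proj\<close> with its dual space.\<close>

definition hyperplane :: "'n::finite proj \<Rightarrow> 'n proj set" where
  "hyperplane h = {p. \<forall>a\<in>line_of h. \<forall>v\<in>line_of p. (\<Sum>i\<in>UNIV. a $ i * v $ i) = 0}"


section \<open>Polynomials in the homogeneous coordinates\<close>

text \<open>An exponent vector is a \<open>'n \<Rightarrow>\<^sub>0 nat\<close>; multiplication in \<open>'n mpoly\<close> is the
  convolution product of \<^theory>\<open>HOL-Library.Poly_Mapping\<close>, i.e. the product of polynomials.\<close>

type_synonym 'n mpoly = "('n \<Rightarrow>\<^sub>0 nat) \<Rightarrow>\<^sub>0 complex"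

definition mono_eval :: "('n::finite \<Rightarrow>\<^sub>0 nat) \<Rightarrow> complex ^ 'n \<Rightarrow> complex" where
  "mono_eval m v = (\<Prod>i\<in>UNIV. v $ i ^ Poly_Mapping.lookup m i)"

definition peval :: "'n::finite mpoly \<Rightarrow> complex ^ 'n \<Rightarrow> complex" where
  "peval F v = (\<Sum>m\<in>Poly_Mapping.keys F. Poly_Mapping.lookup F m * mono_eval m v)"

definition homogeneous :: "nat \<Rightarrow> 'n::finite mpoly \<Rightarrow> bool" where
  "homogeneous k F \<longleftrightarrow>
     (\<forall>m\<in>Poly_Mapping.keys F. (\<Sum>i\<in>UNIV. Poly_Mapping.lookup m i) = k)"

lemma mono_eval_add: "mono_eval (m + n) v = mono_eval m v * mono_eval n v"
  by (simp add: mono_eval_def lookup_add power_add prod.distrib)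

lemma mono_eval_zero [simp]: "mono_eval 0 v = 1"
  by (simp add: mono_eval_def)

lemma peval_superset:
  assumes "finite A" "Poly_Mapping.keys F \<subseteq> A"
  shows "peval F v = (\<Sum>m\<in>A. Poly_Mapping.lookup F m * mono_eval m v)"
  unfolding peval_def using assms
  by (intro sum.mono_neutral_left) (auto simp: in_keys_iff)

lemma peval_zero [simp]: "peval 0 v = 0"
  by (simp add: peval_def)

lemma peval_add: "peval (F + G) v = peval F v + peval G v"
proof -
  let ?A = "Poly_Mapping.keys F \<union> Poly_Mapping.keys G"
  have "peval (F + G) v = (\<Sum>m\<in>?A. Poly_Mapping.lookup (F + G) m * mono_eval m v)"
    by (intro peval_superset) (auto dest: subsetD[OF Poly_Mapping.keys_add])
  also have "\<dots> = (\<Sum>m\<in>?A. Poly_Mapping.lookup F m * mono_eval m v)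
      + (\<Sum>m\<in>?A. Poly_Mapping.lookup G m * mono_eval m v)"
    by (simp add: lookup_add algebra_simps sum.distrib)
  also have "\<dots> = peval F v + peval G v"
    using peval_superset[of ?A F v] peval_superset[of ?A G v] by simp
  finally show ?thesis .
qed

lemma peval_single [simp]: "peval (Poly_Mapping.single m c) v = c * mono_eval m v"
  by (simp add: peval_def)

lemma peval_one [simp]: "peval 1 v = 1"
  using peval_single[of 0 1 v] by simp

lemma mpoly_induct [case_names zero add]:
  fixes F :: "'n::finite mpoly"
  assumes "P 0" "\<And>F m c. P F \<Longrightarrow> P (F + Poly_Mapping.single m c)"
  shows "P F"
proof (induction F rule: Poly_Mapping.update_induct)
  case const
  show ?case by (rule assms(1))
next
  case (update f a b)
  have "Poly_Mapping.update a b f = f + Poly_Mapping.single a b"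
    using update by (intro poly_mapping_eqI)
      (auto simp: lookup_add lookup_update lookup_single in_keys_iff when_def)
  then show ?case using assms(2) update by simp
qed

lemma peval_mult: "peval (F * G) v = peval F v * peval G v"
proof -
  have *: "peval (F * Poly_Mapping.single n d) v = peval F v * (d * mono_eval n v)" for F n d
    by (induction F rule: mpoly_induct)
      (simp_all add: distrib_right peval_add mult_single mono_eval_add)
  show ?thesis
    by (induction G rule: mpoly_induct) (simp_all add: distrib_left peval_add *)
qed

lemma homogeneous_mult:
  assumes "homogeneous j F" "homogeneous k G"
  shows "homogeneous (j + k) (F * G)"
  unfolding homogeneous_def
proof
  fix m assume "m \<in> Poly_Mapping.keys (F * G)"
  then obtain a b where "m = a + b" "a \<in> Poly_Mapping.keys F" "b \<in> Poly_Mapping.keys G"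
    using Poly_Mapping.keys_mult[of F G] by blast
  then show "(\<Sum>i\<in>UNIV. Poly_Mapping.lookup m i) = j + k"
    using assms by (simp add: homogeneous_def lookup_add sum.distrib)
qed

lemma peval_scale:
  assumes "homogeneous k F"
  shows "peval F (c *s v) = c ^ k * peval F v"
proof -
  have "mono_eval m (c *s v) = c ^ k * mono_eval m v" if "m \<in> Poly_Mapping.keys F" for m
    using assms that
    by (simp add: mono_eval_def homogeneous_def power_mult_distrib prod.distrib
        flip: power_sum)
  then show ?thesis
    by (simp add: peval_def sum_distrib_left algebra_simps)
qed


section \<open>The Zariski topology\<close>

definition proj_zeros :: "'n::finite mpoly set \<Rightarrow> 'n proj set" where
  "proj_zeros S = {p. \<forall>F\<in>S. \<forall>v\<in>line_of p. peval F v = 0}"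

definition algebraic_set :: "'n::finite proj set \<Rightarrow> bool" where
  "algebraic_set Z \<longleftrightarrow> (\<exists>S. (\<forall>F\<in>S. \<exists>k. homogeneous k F) \<and> Z = proj_zeros S)"

definition zariski :: "'n::finite proj topology" where
  "zariski = topology (\<lambda>U. algebraic_set (- U))"

lemma line_of_span: "\<exists>v. v \<noteq> 0 \<and> line_of p = vec.span {v}"
  using line_of[of p] by blast

lemma line_of_nonzero: "\<exists>v. v \<noteq> 0 \<and> v \<in> line_of p"
  using line_of_span[of p] vec.span_base[OF singletonI] by metis

lemma proj_zeros_homogeneous_iff:
  assumes "homogeneous k F" "v \<noteq> 0" "v \<in> line_of p"
  shows "(\<forall>w\<in>line_of p. peval F w = 0) \<longleftrightarrow> peval F v = 0"
proof -
  obtain u where u: "line_of p = vec.span {u}"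
    using line_of_span by blast
  then obtain c where c: "v = c *s u"
    using assms(3) by (auto simp: vec.span_singleton)
  with assms(2) have "c \<noteq> 0" by auto
  with c have "u = inverse c *s v"
    by simp
  then have "line_of p \<subseteq> range (\<lambda>e. e *s v)"
    using u by (force simp: vec.span_singleton)
  then show ?thesis
    using assms(3) peval_scale[OF assms(1)] by fastforce
qed

lemma algebraic_set_Union:
  assumes "algebraic_set Y" "algebraic_set Z"
  shows "algebraic_set (Y \<union> Z)"
proof -
  obtain S T where S: "\<forall>F\<in>S. \<exists>k. homogeneous k F" "Y = proj_zeros S"
    and T: "\<forall>F\<in>T. \<exists>k. homogeneous k F" "Z = proj_zeros T"
    using assms unfolding algebraic_set_def by blast
  let ?R = "{F * G | F G. F \<in> S \<and> G \<in> T}"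
  have "\<forall>H\<in>?R. \<exists>k. homogeneous k H"
    using S(1) T(1) homogeneous_mult by fastforce
  moreover have "Y \<union> Z = proj_zeros ?R"
  proof
    show "Y \<union> Z \<subseteq> proj_zeros ?R"
      unfolding S(2) T(2) by (auto simp: proj_zeros_def peval_mult)
    show "proj_zeros ?R \<subseteq> Y \<union> Z"
    proof (rule subsetI, rule ccontr)
      fix p assume p: "p \<in> proj_zeros ?R" and n: "p \<notin> Y \<union> Z"
      obtain v where v: "v \<noteq> 0" "v \<in> line_of p"
        using line_of_nonzero by blast
      from n obtain F G where "F \<in> S" "G \<in> T" "peval F v \<noteq> 0" "peval G v \<noteq> 0"
        using proj_zeros_homogeneous_iff[OF _ v] S T
        unfolding proj_zeros_def by blast
      moreover from this have "peval (F * G) v = 0"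
        using p v(2) unfolding proj_zeros_def by blast
      ultimately show False by (simp add: peval_mult)
    qed
  qed
  ultimately show ?thesis unfolding algebraic_set_def by blast
qed

lemma algebraic_set_Inter:
  assumes "\<forall>Z\<in>\<K>. algebraic_set Z"
  shows "algebraic_set (\<Inter>\<K>)"
proof -
  obtain S where S: "\<And>Z. Z \<in> \<K> \<Longrightarrow> (\<forall>F\<in>S Z. \<exists>k. homogeneous k F) \<and> Z = proj_zeros (S Z)"
    using assms unfolding algebraic_set_def by metis
  have "\<Inter>\<K> = (\<Inter>Z\<in>\<K>. proj_zeros (S Z))"
    using S by auto
  also have "\<dots> = proj_zeros (\<Union>Z\<in>\<K>. S Z)"
    unfolding proj_zeros_def by blast
  finally have "\<Inter>\<K> = proj_zeros (\<Union>Z\<in>\<K>. S Z)" .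
  moreover have "\<forall>F\<in>(\<Union>Z\<in>\<K>. S Z). \<exists>k. homogeneous k F"
    using S by blast
  ultimately show ?thesis unfolding algebraic_set_def by blast
qed

lemma openin_zariski: "openin zariski U \<longleftrightarrow> algebraic_set (- U)"
proof -
  have "istopology (\<lambda>U :: 'a proj set. algebraic_set (- U))"
    unfolding istopology_def
  proof (intro conjI allI impI)
    fix S T :: "'a proj set"
    assume "algebraic_set (- S)" "algebraic_set (- T)"
    then show "algebraic_set (- (S \<inter> T))"
      using algebraic_set_Union by (simp add: Compl_Int)
  next
    fix \<K> :: "'a proj set set"
    assume "\<forall>K\<in>\<K>. algebraic_set (- K)"
    then have "algebraic_set (\<Inter>(uminus ` \<K>))"
      by (intro algebraic_set_Inter) auto
    then show "algebraic_set (- \<Union>\<K>)"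
      by (simp add: uminus_Sup)
  qed
  then show ?thesis by (simp add: zariski_def)
qed

lemma topspace_zariski [simp]: "topspace zariski = UNIV"
proof -
  have "algebraic_set (- UNIV :: 'a proj set)"
    unfolding algebraic_set_def
  proof (intro exI[of _ "{1}"] conjI)
    have "homogeneous 0 (1 :: 'a mpoly)"
      by (simp add: homogeneous_def)
    then show "\<forall>F\<in>{1 :: 'a mpoly}. \<exists>k. homogeneous k F" by blast
    show "- UNIV = proj_zeros {1 :: 'a mpoly}"
      using line_of_nonzero by (auto simp: proj_zeros_def)
  qed
  then show ?thesis
    using openin_subset[of zariski "UNIV :: 'a proj set"] by (auto simp: openin_zariski)
qed

lemma closedin_zariski: "closedin zariski Z \<longleftrightarrow> algebraic_set Z"
  by (simp add: closedin_def openin_zariski flip: Compl_eq_Diff_UNIV)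

definition irreducible_in :: "'a topology \<Rightarrow> 'a set \<Rightarrow> bool" where
  "irreducible_in T Z \<longleftrightarrow> Z \<subseteq> topspace T \<and> Z \<noteq> {} \<and>
     (\<forall>A B. closedin T A \<and> closedin T B \<and> Z \<subseteq> A \<union> B \<longrightarrow> Z \<subseteq> A \<or> Z \<subseteq> B)"

text \<open>The Krull dimension takes values in \<^typ>\<open>ereal\<close> so that the empty space has
  dimension \<open>-\<infinity>\<close> and unbounded chains would give \<open>\<infinity>\<close>.\<close>

definition krull_dim :: "'a topology \<Rightarrow> ereal" where
  "krull_dim T = Sup {ereal (real n) | n. \<exists>Z :: nat \<Rightarrow> 'a set.
     (\<forall>i\<le>n. closedin T (Z i) \<and> irreducible_in T (Z i)) \<and> (\<forall>i<n. Z i \<subset> Z (Suc i))}"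

definition zdim :: "'n::finite proj set \<Rightarrow> ereal" where
  "zdim W = krull_dim (subtopology zariski W)"

definition projective_curve :: "'n::finite proj set \<Rightarrow> bool" where
  "projective_curve X \<longleftrightarrow> closedin zariski X \<and> irreducible_in zariski X \<and> zdim X = 1"


section \<open>Rationality and degree of curves\<close>

text \<open>Regular maps between subsets of projective spaces: locally given by forms of a common
  degree without common zeros.\<close>

definition regular_on :: "'m::finite proj set \<Rightarrow> ('m proj \<Rightarrow> 'n::finite proj) \<Rightarrow> bool" where
  "regular_on U f \<longleftrightarrow>
     (\<forall>p\<in>U. \<exists>V k (F :: 'n \<Rightarrow> 'm mpoly).
        openin (subtopology zariski U) V \<and> p \<in> V \<and> (\<forall>i. homogeneous k (F i)) \<and>
        (\<forall>q\<in>V. \<forall>v\<in>line_of q - {0}.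
           (\<chi> i. peval (F i) v) \<noteq> 0 \<and> (\<chi> i. peval (F i) v) \<in> line_of (f q)))"

text \<open>For irreducible closed \<open>X\<close> and \<open>Y\<close>: they have isomorphic non-empty open subsets.\<close>

definition birational :: "'m::finite proj set \<Rightarrow> 'n::finite proj set \<Rightarrow> bool" where
  "birational X Y \<longleftrightarrow>
     (\<exists>U V f g.
        openin (subtopology zariski X) U \<and> U \<noteq> {} \<and>
        openin (subtopology zariski Y) V \<and> V \<noteq> {} \<and>
        regular_on U f \<and> regular_on V g \<and> f ` U \<subseteq> V \<and> g ` V \<subseteq> U \<and>
        (\<forall>x\<in>U. g (f x) = x) \<and> (\<forall>y\<in>V. f (g y) = y))"

definition rational_curve :: "'n::finite proj set \<Rightarrow> bool" where
  "rational_curve X \<longleftrightarrow> projective_curve X \<and> birational X (UNIV :: 2 proj set)"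

text \<open>A projective curve has degree \<open>d\<close> if a general hyperplane meets it in exactly \<open>d\<close>
  points. The value \<open>d\<close> is unique, as non-empty open subsets of the dual space meet.\<close>

definition curve_has_degree :: "'n::finite proj set \<Rightarrow> nat \<Rightarrow> bool" where
  "curve_has_degree X d \<longleftrightarrow>
     (\<exists>U. openin zariski U \<and> U \<noteq> {} \<and>
        (\<forall>h\<in>U. finite (X \<inter> hyperplane h) \<and> card (X \<inter> hyperplane h) = d))"


section \<open>Ranks, rank loci, secant varieties and joins\<close>

text \<open>For non-degenerate \<open>X\<close> some \<open>r\<close> always exists, so \<open>LEAST\<close> is the minimum.\<close>

definition X_rank :: "'n::finite proj set \<Rightarrow> 'n proj \<Rightarrow> nat" where
  "X_rank X p = (LEAST r. \<exists>ps. length ps = r \<and> set ps \<subseteq> X \<and> p \<in> proj_span (set ps))"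

definition rank_locus :: "'n::finite proj set \<Rightarrow> nat \<Rightarrow> 'n proj set" where
  "rank_locus X k = zariski closure_of {p. X_rank X p = k}"

definition secant_variety :: "nat \<Rightarrow> 'n::finite proj set \<Rightarrow> 'n proj set" where
  "secant_variety k X =
     zariski closure_of (\<Union>ps\<in>{ps. length ps = k \<and> set ps \<subseteq> X}. proj_span (set ps))"

definition proj_join :: "'n::finite proj set \<Rightarrow> 'n proj set \<Rightarrow> 'n proj set" where
  "proj_join W X =
     zariski closure_of (\<Union>(w, x)\<in>{(w, x). w \<in> W \<and> x \<in> X \<and> w \<noteq> x}. proj_span {w, x})"

end

(*
  X is the closure of the points (1 : t : t^2 : t^3 : t^d), that is, these points together with the
  apex (0 : 0 : 0 : 0 : 1), from which X projects to the twisted cubic. A decomposition of a point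
  into three points of X with parameters x, y, z is a linear recurrence with characteristic roots
  x, y, z whose terms 0, ..., 3 and d are the coordinates of the point. If the first four of them
  lie on a secant of the twisted cubic, the apex serves as third point. Otherwise they lie on a
  tangent or on a line through the point at infinity; the admissible recurrences then form an affine
  plane, on which the term with index d is a polynomial function. A level set of this function is a
  curve, while the recurrences with a double root in the level set are finite in number, since the
  function restricted to the discriminant curve is not constant; hence some recurrence has three
  distinct roots. So every point off the tangent line x0 = x1 = x2 = 0 at the apex has rank at
  most 3: this line contains W_4, and its join with X lies in the quadric x0 x2 = x1^2. Points on a
  plane spanned by the apex and a secant have rank 3 and are dense.
*)
theory Submission
  imports "Jordan_Normal_Form.Determinant" Defs
    "HOL-Computational_Algebra.Fundamental_Theorem_Algebra"
begin

text \<open>Translating the parameter moves the point of tangency, or the finite point of a line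
  through the point at infinity, to 0. The four known terms then become (a0, s, 0, 0) on a tangent,
  (a0, 0, 0, s) on a line through the point at infinity, and (0, 0, a2, a3) on the tangent at
  infinity, where no translation is made. With e1, e2, e3 the elementary symmetric functions of the
  roots, admissibility reads e2 = (a0/s) e3, e3 = s/a0 and e1 = a3/a2 respectively: these are the
  affine planes. Each time there are two consecutive zeros, so from there on the sequence is a
  multiple of the complete homogeneous symmetric functions of the roots. These are monic in e1;
  hence in the first two cases a generic value of the other free parameter is chosen and e1 is
  solved for, which on a tangent requires d > 4. In the last case e1 is fixed, and a generic root
  replaces the generic parameter. Distinctness of the roots is what makes the Vandermonde system for
  the three weights solvable.\<close>

no_notation Matrix.vec_index (infixl "$" 100)

section \<open>Complete homogeneous symmetric functions of three roots\<close>

text \<open>The arguments are the elementary symmetric functions of the roots; the value is the complete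
  homogeneous symmetric function of degree \<open>n\<close>.\<close>

fun hsym :: "'a::comm_ring_1 \<Rightarrow> 'a \<Rightarrow> 'a \<Rightarrow> nat \<Rightarrow> 'a" where
  "hsym a b c 0 = 1"
| "hsym a b c (Suc 0) = a"
| "hsym a b c (Suc (Suc 0)) = a\<^sup>2 - b"
| "hsym a b c (Suc (Suc (Suc n))) =
     a * hsym a b c (Suc (Suc n)) - b * hsym a b c (Suc n) + c * hsym a b c n"

lemma nat_induct3 [case_names 0 1 2 Suc]:
  assumes "P 0" "P (Suc 0)" "P (Suc (Suc 0))"
    "\<And>n. P n \<Longrightarrow> P (Suc n) \<Longrightarrow> P (Suc (Suc n)) \<Longrightarrow> P (Suc (Suc (Suc n)))"
  shows "P n"
proof -
  have "P n \<and> P (Suc n) \<and> P (Suc (Suc n))"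
    by (induction n) (use assms in blast)+
  then show ?thesis by blast
qed

text \<open>Lets \<open>hsym\<close> over a polynomial ring describe a one-parameter family of
  cubics, so that its values can be studied by degree and leading coefficient.\<close>

lemma poly_hsym: "poly (hsym p q r n) x = hsym (poly p x) (poly q x) (poly r x) n"
  by (induction n rule: nat_induct3) simp_all

text \<open>The arguments have weights 1, 2, 3: multiplying all roots by \<open>l\<close> multiplies
  them by \<open>l\<close>, \<open>l^2\<close>, \<open>l^3\<close>. This is how denominators are
  cleared below.\<close>

lemma hsym_scale: "hsym (l * a) (l^2 * b) (l^3 * c) n = l ^ n * hsym a b c n"
  by (induction n rule: nat_induct3) (simp_all add: algebra_simps power_mult_distrib
    power2_eq_square power3_eq_cube)

lemma hsym_single: "hsym a 0 0 n = a ^ n"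
  by (induction n rule: nat_induct3) (simp_all add: power2_eq_square)

lemma coeff_mult_top:
  fixes p q :: "'a::comm_semiring_0 poly"
  assumes "degree p \<le> m" "degree q \<le> n"
  shows "coeff (p * q) (m + n) = coeff p m * coeff q n"
proof -
  have "coeff p i * coeff q (m + n - i) = 0" if "i \<le> m + n" "i \<noteq> m" for i
    using assms that by (cases "i < m") (auto simp: coeff_eq_0)
  then have "(\<Sum>i\<le>m + n. coeff p i * coeff q (m + n - i))
      = (\<Sum>i\<in>{m}. coeff p i * coeff q (m + n - i))"
    by (intro sum.mono_neutral_right) auto
  then show ?thesis by (simp add: coeff_mult)
qed

text \<open>Every monomial of \<open>hsym\<close> has total weight \<open>n\<close>, so degrees
  bounded by the weights give degree at most \<open>n\<close>, and passing to top coefficients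
  commutes with the recurrence.\<close>

lemma hsym_degree_coeff:
  fixes p q r :: "'a::comm_ring_1 poly"
  assumes "degree p \<le> 1" "degree q \<le> 2" "degree r \<le> 3"
  shows "degree (hsym p q r n) \<le> n \<and>
    coeff (hsym p q r n) n = hsym (coeff p 1) (coeff q 2) (coeff r 3) n"
proof (induction n rule: less_induct)
  case (less n)
  consider "n = 0" | "n = 1" | "n = 2" | m where "n = Suc (Suc (Suc m))"
    by (metis One_nat_def Suc_1 not0_implies_Suc)
  then show ?case
  proof cases
    case 3
    have "degree (p * p) \<le> 2" using assms(1) degree_mult_le[of p p] by linarith
    moreover have "coeff (p * p) (1 + 1) = coeff p 1 * coeff p 1"
      using coeff_mult_top assms(1) by blast
    ultimately show ?thesis using 3 assms
      by (auto simp: power2_eq_square numeral_2_eq_2 intro: degree_diff_le)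
  next
    case 4
    let ?h = "hsym p q r"
    have 1: "degree (?h (m+2)) \<le> m+2" "degree (?h (m+1)) \<le> m+1" "degree (?h m) \<le> m"
      "coeff (?h (m+2)) (m+2) = hsym (coeff p 1) (coeff q 2) (coeff r 3) (m+2)"
      "coeff (?h (m+1)) (m+1) = hsym (coeff p 1) (coeff q 2) (coeff r 3) (m+1)"
      "coeff (?h m) m = hsym (coeff p 1) (coeff q 2) (coeff r 3) m"
      using less 4 by auto
    have "degree (p * ?h (m+2)) \<le> n" "degree (q * ?h (m+1)) \<le> n" "degree (r * ?h m) \<le> n"
      using degree_mult_le[of p "?h (m+2)"] degree_mult_le[of q "?h (m+1)"]
        degree_mult_le[of r "?h m"] 1 assms 4 by linarith+
    moreover have "coeff (p * ?h (m+2)) (1 + (m+2)) = coeff p 1 * coeff (?h (m+2)) (m+2)"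
      "coeff (q * ?h (m+1)) (2 + (m+1)) = coeff q 2 * coeff (?h (m+1)) (m+1)"
      "coeff (r * ?h m) (3 + m) = coeff r 3 * coeff (?h m) m"
      using 1 assms by (intro coeff_mult_top; simp)+
    ultimately show ?thesis using 1 4
      by (auto intro!: degree_add_le degree_diff_le simp: numeral_2_eq_2 numeral_3_eq_3)
  qed (use assms in auto)
qed

text \<open>For a sum \<open>p\<close> of powers with \<open>p k = s * hsym a b c (k - m)\<close> for all \<open>k \<ge> m\<close>, the product
  \<open>s * hsum \<tau> m d a b c\<close> collects the terms \<open>k \<ge> m\<close> of \<open>p d\<close> after shifting all bases by \<open>\<tau>\<close>.\<close>

definition hsum :: "'a::comm_ring_1 \<Rightarrow> nat \<Rightarrow> nat \<Rightarrow> 'a \<Rightarrow> 'a \<Rightarrow> 'a \<Rightarrow> 'a" where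
  "hsum \<tau> m d a b c = (\<Sum>k=m..d. of_nat (d choose k) * \<tau> ^ (d - k) * hsym a b c (k - m))"

lemma poly_hsum:
  "poly (hsum t m d p q r) x = hsum (poly t x) m d (poly p x) (poly q x) (poly r x)"
  by (simp add: hsum_def poly_sum poly_hsym)

lemma hsum_scale:
  "hsum (l * \<tau>) m d (l * a) (l^2 * b) (l^3 * c) = l ^ (d - m) * hsum \<tau> m d a b c"
proof -
  have "l ^ (d - m) = l ^ (d - k) * l ^ (k - m)" if "k \<in> {m..d}" for k
    using that by (simp flip: power_add)
  then show ?thesis
    unfolding hsum_def sum_distrib_left hsym_scale power_mult_distrib
    by (intro sum.cong) (simp_all add: mult_ac)
qed

lemma hsum_zero: "m \<le> d \<Longrightarrow> hsum 0 m d a b c = hsym a b c (d - m)"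
proof -
  assume "m \<le> d"
  have "hsum 0 m d a b c = (\<Sum>k\<in>{d}. of_nat (d choose k) * 0 ^ (d - k) * hsym a b c (k - m))"
    unfolding hsum_def using \<open>m \<le> d\<close> by (intro sum.mono_neutral_right) (auto simp: power_0_left)
  then show ?thesis by simp
qed

text \<open>The shift is a constant polynomial and adds no degree; only the summand
  \<open>k = d\<close> can therefore reach degree \<open>d - m\<close>.\<close>

lemma coeff_hsum_top:
  fixes p q r :: "'a::comm_ring_1 poly"
  assumes "degree p \<le> 1" "degree q \<le> 2" "degree r \<le> 3" "m \<le> d"
  shows "coeff (hsum [:t:] m d p q r) (d - m) = hsym (coeff p 1) (coeff q 2) (coeff r 3) (d - m)"
proof -
  note h = hsym_degree_coeff[OF assms(1-3)]
  have *: "of_nat (d choose k) * [:t:] ^ (d - k) * hsym p q r (k - m)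
      = Polynomial.smult (of_nat (d choose k) * t ^ (d - k)) (hsym p q r (k - m))" for k
    by (simp add: of_nat_poly poly_const_pow mult.commute)
  have "coeff (of_nat (d choose k) * [:t:] ^ (d - k) * hsym p q r (k - m)) (d - m) =
      (if k = d then hsym (coeff p 1) (coeff q 2) (coeff r 3) (d - m) else 0)" if "k \<in> {m..d}" for k
  proof (cases "k = d")
    case False
    then have "coeff (hsym p q r (k - m)) (d - m) = 0"
      using h[of "k - m"] that by (intro coeff_eq_0) (auto simp: less_diff_conv intro:
        le_less_trans)
    with False show ?thesis unfolding * by simp
  qed (use h in \<open>simp only: *, simp\<close>)
  then show ?thesis
    using assms(4) by (simp add: hsum_def coeff_sum)
qed

section \<open>Roots of cubics and weights at three nodes\<close>

lemma complex_poly_root: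
  fixes p :: "complex poly"
  assumes "coeff p n \<noteq> 0" "n > 0"
  shows "\<exists>x. poly p x = 0"
proof -
  have "degree p \<noteq> 0" using le_degree[OF assms(1)] assms(2) by linarith
  then have "\<not> constant (poly p)" by (simp add: constant_degree)
  then show ?thesis by (rule fundamental_theorem_of_algebra)
qed

lemma quadratic_roots:
  fixes a b :: complex
  obtains x y where "a = x + y" "b = x * y"
proof -
  obtain x where x: "poly [:b, -a, 1:] x = 0"
    using complex_poly_root[of "[:b, -a, 1:]" 2] by (auto simp: numeral_2_eq_2)
  show ?thesis
    by (rule that[of x "a - x"]) (use x in \<open>simp_all add: algebra_simps add_eq_0_iff2\<close>)
qed

lemma cubic_roots:
  fixes a b c :: complex
  obtains x y z where "a = x + y + z" "b = x * y + y * z + z * x" "c = x * y * z"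
proof -
  obtain x where x: "poly [:-c, b, -a, 1:] x = 0"
    using complex_poly_root[of "[:-c, b, -a, 1:]" 3] by (auto simp: numeral_3_eq_3)
  obtain y z where yz: "a - x = y + z" "b - x * (a - x) = y * z"
    by (rule quadratic_roots)
  have "c = x * (b - x * (a - x))" using x by (simp add: algebra_simps)
  then have "c = x * y * z" using yz by simp
  moreover have "a = x + y + z" using yz(1) by (simp add: algebra_simps)
  moreover from this have "b = x * y + y * z + z * x" using yz(2) by (simp add: algebra_simps)
  ultimately show ?thesis using that by blast
qed

lemma cubic_roots_cases:
  fixes a b c :: complex
  obtains (distinct) x y z where "distinct [x, y, z]" "a = x + y + z" "b = x*y + y*z + z*x"
    "c = x*y*z"
    | (double) u v where "a = 2*u + v" "b = u^2 + 2 * u * v" "c = u^2 * v"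
proof -
  obtain x y z where r: "a = x + y + z" "b = x*y + y*z + z*x" "c = x*y*z"
    by (rule cubic_roots)
  consider "distinct [x, y, z]" | "x = y" | "x = z" | "y = z" by auto
  then show ?thesis
  proof cases
    case 1 with r distinct show ?thesis by blast
  next
    case 2 with r show ?thesis by (intro double[of x z]) (simp_all add: algebra_simps
      power2_eq_square)
  next
    case 3 with r show ?thesis by (intro double[of x y]) (simp_all add: algebra_simps
      power2_eq_square)
  next
    case 4 with r show ?thesis by (intro double[of y x]) (simp_all add: algebra_simps
      power2_eq_square)
  qed
qed

lemma vandermonde3:
  fixes x y z :: complex
  assumes "distinct [x, y, z]"
  obtains c1 c2 c3 where "c1 + c2 + c3 = s0" "c1 * x + c2 * y + c3 * z = s1"
    "c1 * x\<^sup>2 + c2 * y\<^sup>2 + c3 * z\<^sup>2 = s2"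
proof -
  define D where "D = (x - y) * (y - z) * (z - x)"
  have D: "D \<noteq> 0" using assms by (auto simp: D_def)
  \<comment> \<open>Applying the quadratic with roots \<open>y\<close>, \<open>z\<close> to the
    sequence kills the other two weights and leaves \<open>c1 * (x - y) * (x - z)\<close>; the last
    factor completes this to \<open>c1 * D\<close>. The same holds cyclically.\<close>
  let ?A = "(s2 - (y + z) * s1 + y * z * s0) * (z - y)"
  let ?B = "(s2 - (x + z) * s1 + x * z * s0) * (x - z)"
  let ?C = "(s2 - (x + y) * s1 + x * y * s0) * (y - x)"
  have "?A + ?B + ?C = D * s0" "?A * x + ?B * y + ?C * z = D * s1"
    "?A * x\<^sup>2 + ?B * y\<^sup>2 + ?C * z\<^sup>2 = D * s2"
    unfolding D_def by (simp_all add: algebra_simps power2_eq_square)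
  with D show ?thesis
    by (intro that[of "?A / D" "?B / D" "?C / D"])
      (simp_all add: add_divide_distrib[symmetric])
qed

section \<open>Power sums as linear recurrences\<close>

text \<open>Both sides obey the recurrence with characteristic roots \<open>x\<close>,
  \<open>y\<close>, \<open>z\<close>, and the two zeros at \<open>j\<close> and \<open>Suc j\<close>
  match the values 0 of the complete symmetric functions in degrees -2 and -1.\<close>

lemma power_sum_hsym:
  fixes x y z c1 c2 c3 :: "'a::comm_ring_1"
  defines "p \<equiv> \<lambda>k. c1 * x ^ k + c2 * y ^ k + c3 * z ^ k"
  assumes "p j = 0" "p (Suc j) = 0"
  shows "p (Suc (Suc j) + k) = p (Suc (Suc j)) * hsym (x + y + z) (x*y + y*z + z*x) (x*y*z) k"
proof -
  have rec: "p (Suc (Suc (Suc i))) = (x + y + z) * p (Suc (Suc i)) - (x*y + y*z + z*x) * p (Suc i)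
      + x*y*z * p i" for i
    unfolding p_def by (simp add: algebra_simps)
  show ?thesis
  proof (induction k rule: nat_induct3)
    case 1
    show ?case using rec[of j] assms(2,3) by simp
  next
    case 2
    show ?case using rec[of "Suc j"] rec[of j] assms(2,3)
      by (simp add: power2_eq_square algebra_simps)
  next
    case (Suc n)
    then show ?case using rec[of "Suc (Suc j) + n"] by (simp add: algebra_simps)
  qed simp
qed

lemma shifted_power_sum:
  fixes x y z c1 c2 c3 t :: "'a::comm_ring_1"
  defines "p \<equiv> \<lambda>k. c1 * x ^ k + c2 * y ^ k + c3 * z ^ k"
  shows "c1 * (t + x) ^ d + c2 * (t + y) ^ d + c3 * (t + z) ^ d
    = (\<Sum>k\<le>d. of_nat (d choose k) * t ^ (d - k) * p k)"
  unfolding p_def add.commute[of t] binomial_ring sum_distrib_left sum.distrib[symmetric]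
  by (intro sum.cong) (simp_all add: algebra_simps)

text \<open>In the binomial expansion around \<open>t\<close> the two zeros separate the known low
  terms from a tail in which every term is a multiple of the first one.\<close>

lemma shifted_power_sum_hsum:
  fixes x y z c1 c2 c3 t :: "'a::comm_ring_1"
  defines "p \<equiv> \<lambda>k. c1 * x ^ k + c2 * y ^ k + c3 * z ^ k"
  assumes "p j = 0" "p (Suc j) = 0" "Suc j < d"
  shows "c1 * (t + x) ^ d + c2 * (t + y) ^ d + c3 * (t + z) ^ d
    = (\<Sum>k<j. of_nat (d choose k) * t ^ (d - k) * p k)
      + p (Suc (Suc j)) * hsum t (Suc (Suc j)) d (x + y + z) (x*y + y*z + z*x) (x*y*z)"
proof -
  let ?f = "\<lambda>k. of_nat (d choose k) * t ^ (d - k) * p k"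
  have "{..d} = {..<j} \<union> {j, Suc j} \<union> {Suc (Suc j)..d}" using assms(4) by auto
  then have "sum ?f {..d} = sum ?f ({..<j} \<union> {j, Suc j} \<union> {Suc (Suc j)..d})" by simp
  also have "\<dots> = sum ?f {..<j} + sum ?f {j, Suc j} + sum ?f {Suc (Suc j)..d}"
    by (subst sum.union_disjoint; (subst sum.union_disjoint)?) auto
  also have "sum ?f {j, Suc j} = 0" using assms(2,3) by simp
  also have "sum ?f {Suc (Suc j)..d} = p (Suc (Suc j)) *
      hsum t (Suc (Suc j)) d (x + y + z) (x*y + y*z + z*x) (x*y*z)"
    unfolding hsum_def sum_distrib_left
  proof (intro sum.cong refl)
    fix k assume "k \<in> {Suc (Suc j)..d}"
    then obtain i where "k = Suc (Suc j) + i" by (auto simp: le_iff_add)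
    then have "p k = p (Suc (Suc j)) * hsym (x + y + z) (x*y + y*z + z*x) (x*y*z) (k - Suc (Suc j))"
      using power_sum_hsym[of c1 x j c2 y c3 z i] assms(2,3)
      by (simp add: p_def del: power_Suc)
    then show "?f k = p (Suc (Suc j)) * (of_nat (d choose k) * t ^ (d - k) *
        hsym (x + y + z) (x*y + y*z + z*x) (x*y*z) (k - Suc (Suc j)))"
      by (simp add: mult_ac)
  qed
  finally show ?thesis
    using shifted_power_sum[of c1 t x d c2 y c3 z] by (simp add: p_def)
qed

section \<open>Cubics with distinct roots and a prescribed value\<close>

lemma finite_complex_avoid:
  fixes A :: "complex set"
  assumes "finite A"
  obtains x where "x \<notin> A"
  using assms infinite_UNIV_char_0 by (metis UNIV_eq_I)

text \<open>As a polynomial in \<open>a\<close> this is monic of degree \<open>d - m\<close>, which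
  is positive.\<close>

lemma hsum_solve:
  fixes t b c v :: complex
  assumes "m < d"
  obtains a where "hsum t m d a b c = v"
proof -
  let ?P = "hsum [:t:] m d [:0, 1:] [:b:] [:c:] - [:v:]"
  have "coeff ?P (d - m) = hsym 1 0 0 (d - m)"
    using coeff_hsum_top[of "[:0, 1:]" "[:b:]" "[:c:]" m d t] assms
    by (auto simp: coeff_pCons numeral_eq_Suc split: nat.splits)
  then have "coeff ?P (d - m) \<noteq> 0" by (simp add: hsym_single)
  then obtain a where "poly ?P a = 0"
    using complex_poly_root assms by (meson zero_less_diff)
  then show ?thesis using that by (simp add: poly_hsum)
qed

text \<open>The values at the roots 1, -2, -2; modulo 2 the recurrence repeats the previous term.
  They are the leading coefficients that must not vanish for a tangent with \<alpha> = 0.\<close>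

lemma odd_hsym: "odd (hsym (-3) 0 4 n :: int)"
  by (induction n rule: nat_induct3) simp_all

lemma of_int_hsym: "(of_int (hsym a b c n) :: 'a::comm_ring_1)
  = hsym (of_int a) (of_int b) (of_int c) n"
  by (induction n rule: nat_induct3) simp_all

text \<open>Closed form for the roots 1, 1, -2, from the partial fractions of the generating
  function. Its exponential term shows that the value is nonzero for large \<open>n\<close>.\<close>

lemma hsym_112: "9 * hsym 0 (-3) (-2) n = 5 + 3 * int n + 4 * (-2) ^ n"
  by (induction n rule: nat_induct3) simp_all

text \<open>The constraint on the roots is admissibility for a shifted sequence
  \<open>a0, s, 0, 0\<close> with \<alpha> = \<open>a0 / s\<close>. Its term 4 is
  \<open>x*y*z * s\<close>, whence the extra factor in front of \<open>hsum\<close>.\<close>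

lemma tangent_squarefree:
  fixes \<alpha> t v :: complex
  assumes "d \<ge> 5"
  obtains x y z where "distinct [x, y, z]" "x*y + y*z + z*x = \<alpha> * (x*y*z)"
    "x*y*z * hsum t 4 d (x + y + z) (x*y + y*z + z*x) (x*y*z) = v"
proof -
  \<comment> \<open>For a double root \<open>x\<close> the simple root must be \<open>x / (\<alpha> * x - 2)\<close>; substituting this into the
    equation and clearing denominators gives the polynomial \<open>R\<close>.\<close>
  define l u where "l = [:-2, \<alpha>:]" and "u = ([:0, 1:] :: complex poly)"
  define H where "H = hsum (l * [:t:]) 4 d (l * (2 * u) + u) (l^2 * u^2 + 2 * l * u^2) (l^2 * u^3)"
  define R where "R = u ^ 3 * H - Polynomial.smult v (l ^ (d - 3))"
  have "R \<noteq> 0"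
  proof (cases "\<alpha> = 0")
    case True
    have 1: "l = [:-2:]" using True by (simp add: l_def)
    have u3: "u ^ 3 = monom 1 3" by (simp add: u_def monom_altdef)
    \<comment> \<open>For \<alpha> = 0 the simple root is \<open>- u / 2\<close>; scaled by
      \<open>l = -2\<close> the roots are \<open>-2 * u\<close>, \<open>-2 * u\<close>,
      \<open>u\<close>, with symmetric functions \<open>-3 * u\<close>, 0,
      \<open>4 * u^3\<close>.\<close>
    have H: "H = hsum [:- (t * 2):] 4 d [:0, -3:] 0 (monom 4 3)"
      unfolding H_def 1 using u3 by (simp add: u_def power2_eq_square numeral_poly smult_monom)
    have "coeff H (d - 4) = hsym (-3) 0 4 (d - 4)"
      unfolding H using coeff_hsum_top[of "[:0, -3:]" 0 "monom 4 3" 4 d "- (t * 2)"] assms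
      by (simp add: degree_monom_eq)
    also have "\<dots> = of_int (hsym (-3) 0 4 (d - 4))" by (simp add: of_int_hsym)
    also have "\<dots> \<noteq> 0" using odd_hsym[of "d - 4"] by (metis even_zero of_int_eq_0_iff)
    finally have "coeff (u ^ 3 * H) (d - 1) \<noteq> 0"
      using assms by (simp add: u3 coeff_monom_mult)
    moreover have "coeff (Polynomial.smult v (l ^ (d - 3))) (d - 1) = 0"
      using assms by (simp add: 1 poly_const_pow coeff_pCons split: nat.split)
    ultimately have "coeff R (d - 1) \<noteq> 0"
      by (simp only: R_def coeff_diff diff_zero not_False_eq_True)
    then show ?thesis by auto
  next
    case False
    \<comment> \<open>At the zero of \<open>l\<close> the shift and the last two arguments vanish,
      so \<open>hsum\<close> collapses to a power of the first argument, which is \<open>u\<close>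
      itself.\<close>
    have "poly H (2 / \<alpha>) = (2 / \<alpha>) ^ (d - 4)"
      using assms False by (simp add: H_def poly_hsum l_def u_def hsum_zero hsym_single)
    then have "poly R (2 / \<alpha>) \<noteq> 0"
      using assms False by (simp add: R_def l_def u_def power_0_left)
    then show ?thesis by auto
  qed
  \<comment> \<open>A bad double root \<open>u\<close> forces the product of the roots to be
    \<open>u^2 * (u / (\<alpha> * u - 2))\<close>. The value 0 is avoided as well since the target
    is divided by \<open>e\<close>.\<close>
  then have "finite (insert 0 ((\<lambda>u. u^3 / (\<alpha> * u - 2)) ` {u. poly R u = 0}))"
    using poly_roots_finite[of R] by simp
  then obtain e where e: "e \<notin> insert 0 ((\<lambda>u. u^3 / (\<alpha> * u - 2)) ` {u. poly R u = 0})"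
    by (rule finite_complex_avoid)
  obtain a where a: "hsum t 4 d a (\<alpha> * e) e = v / e"
    by (rule hsum_solve[of 4 d]) (use assms in auto)
  show ?thesis
  proof (cases a "\<alpha> * e" e rule: cubic_roots_cases)
    case (distinct x y z)
    have "e * hsum t 4 d a (\<alpha> * e) e = v" using a e by simp
    then show ?thesis using that[OF distinct(1)] distinct(2-) by metis
  next
    case (double x y)
    have x: "x \<noteq> 0" "y \<noteq> 0" using e double by auto
    have "x * (x + 2 * y) = x * (\<alpha> * x * y)"
      using double by (simp add: algebra_simps power2_eq_square)
    then have "x + 2 * y = \<alpha> * x * y" using x by simp
    then have y: "(\<alpha> * x - 2) * y = x" by (simp add: algebra_simps)
    define m where "m = \<alpha> * x - 2"
    have xm: "x = m * y" and m: "m \<noteq> 0" using y x by (auto simp: m_def)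
    have ym: "y = x / m" using xm m by simp
    have 1: "poly l x = m" "poly u x = x" by (simp_all add: l_def m_def u_def)
    have e': "\<alpha> * e = x\<^sup>2 + 2 * x * y" "e = x\<^sup>2 * y" "a = 2 * x + y" using double by simp_all
    have "poly H x = hsum (m * t) 4 d (m * a) (m\<^sup>2 * (\<alpha> * e)) (m^3 * e)"
    proof -
      have "m * (2 * x) + x = m * a" using xm e' by (simp add: algebra_simps)
      moreover have "m\<^sup>2 * x\<^sup>2 + 2 * m * x\<^sup>2 = m\<^sup>2 * (\<alpha> * e)"
        unfolding e'(1) ym using m by (simp add: field_simps power2_eq_square)
      moreover have "m\<^sup>2 * x ^ 3 = m ^ 3 * e"
        unfolding e'(2) ym using m by (simp add: field_simps power2_eq_square power3_eq_cube)
      ultimately show ?thesis by (simp add: H_def poly_hsum 1 mult.commute[of t])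
    qed
    then have "poly H x = m ^ (d - 4) * (v / e)" by (simp add: hsum_scale a)
    moreover have "d - 3 = Suc (d - 4)" using assms by simp
    then have "m ^ (d - 3) = m * m ^ (d - 4)" by (simp only: power_Suc)
    moreover have e3: "x ^ 3 = m * e"
      unfolding e'(2) ym using m by (simp add: field_simps power2_eq_square power3_eq_cube)
    ultimately have "poly R x = 0" using e by (simp add: R_def 1)
    moreover have "e = x^3 / m" using e3 m by simp
    ultimately show ?thesis using e by (auto simp: m_def)
  qed
qed

text \<open>With the product of the roots fixed, \<open>b\<close> is taken generic and
  \<open>a\<close> comes from \<open>hsum_solve\<close>; a double root would force \<open>b\<close>
  into a finite set.\<close>

lemma secant_infinity_squarefree:
  fixes \<beta> t v :: complex
  assumes "d \<ge> 4" "\<beta> \<noteq> 0"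
  obtains x y z where "distinct [x, y, z]" "x*y*z = \<beta>"
    "hsum t 3 d (x + y + z) (x*y + y*z + z*x) (x*y*z) = v"
proof -
  \<comment> \<open>For a double root \<open>x\<close> the simple root must be \<open>\<beta> / x\<^sup>2\<close>; clearing denominators gives \<open>R\<close>.\<close>
  define u where "u = ([:0, 1:] :: complex poly)"
  define H where "H = hsum (u^2 * [:t:]) 3 d (2 * u^3 + [:\<beta>:]) (u^6
    + Polynomial.smult (2 * \<beta>) (u^3)) (Polynomial.smult \<beta> (u^6))"
  define R where "R = H - Polynomial.smult v ((u\<^sup>2) ^ (d - 3))"
  \<comment> \<open>At 0 only the summand \<beta> of the first argument survives, while the
    subtracted power of \<open>u\<close> vanishes because \<open>d > 3\<close>.\<close>
  have "poly H 0 = \<beta> ^ (d - 3)"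
    using assms by (simp add: H_def poly_hsum u_def hsum_zero hsym_single)
  then have "poly R 0 \<noteq> 0"
    using assms by (simp add: R_def u_def power_0_left)
  then have "finite ((\<lambda>u. u\<^sup>2 + 2 * u * (\<beta> / u\<^sup>2)) ` {u. poly R u = 0})"
    using poly_roots_finite[of R] by force
  then obtain b where b: "b \<notin> (\<lambda>u. u\<^sup>2 + 2 * u * (\<beta> / u\<^sup>2)) ` {u. poly R u = 0}"
    by (rule finite_complex_avoid)
  obtain a where a: "hsum t 3 d a b \<beta> = v"
    by (rule hsum_solve[of 3 d]) (use assms in auto)
  show ?thesis
  proof (cases a b \<beta> rule: cubic_roots_cases)
    case (distinct x y z)
    then show ?thesis using that[OF distinct(1)] a by metis
  next
    case (double x y)
    have x: "x \<noteq> 0" using assms double by auto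
    have "poly H x = hsum (x\<^sup>2 * t) 3 d (x\<^sup>2 * a) ((x\<^sup>2)\<^sup>2 * b) ((x\<^sup>2)^3 * \<beta>)"
    proof -
      have "2 * x ^ 3 + \<beta> = x\<^sup>2 * a" unfolding double
        by (simp add: algebra_simps power2_eq_square power3_eq_cube)
      moreover have "x ^ 6 + 2 * \<beta> * x ^ 3 = (x\<^sup>2)\<^sup>2 * b"
        unfolding double by (simp add: algebra_simps eval_nat_numeral)
      moreover have "\<beta> * x ^ 6 = (x\<^sup>2) ^ 3 * \<beta>" by simp
      ultimately show ?thesis by (simp add: H_def poly_hsum u_def mult.commute[of t] mult.commute[of
        \<beta>])
    qed
    then have "poly H x = (x\<^sup>2) ^ (d - 3) * v" by (simp only: hsum_scale a)
    then have "poly R x = 0" by (simp add: R_def u_def)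
    moreover have "y = \<beta> / x\<^sup>2" using double x by simp
    ultimately show ?thesis using b double(2) by blast
  qed
qed

lemma tangent_infinity_squarefree:
  fixes \<beta> v :: complex
  assumes "n \<ge> 3"
  obtains x y z where "distinct [x, y, z]" "x + y + z = \<beta>"
    "hsym (x + y + z) (x*y + y*z + z*x) (x*y*z) n = v"
proof -
  \<comment> \<open>\<open>Q\<close> is the value at the roots \<open>x, x, \<beta> - 2 * x\<close>. For a generic first root \<open>r\<close>, the value \<open>F\<close>
    as a function of the product \<open>k\<close> of the other two differs at the two values of \<open>k\<close> that
    produce a double root, so \<open>F\<close> is not constant.\<close>
  define Q where "Q = hsym [:\<beta>:] [:0, 2 * \<beta>, -3:] [:0, 0, \<beta>, -2:] n"
  have Q: "poly Q x = hsym \<beta> (x * (2 * \<beta> - 3 * x)) (x\<^sup>2 * (\<beta> - 2 * x)) n" for x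
    by (simp add: Q_def poly_hsym power2_eq_square algebra_simps)
  have dQ: "degree Q \<le> n \<and> coeff Q n = hsym 0 (-3) (-2) n"
    using hsym_degree_coeff[of "[:\<beta>:]" "[:0, 2 * \<beta>, -3:]" "[:0, 0, \<beta>, -2:]" n]
    by (simp add: Q_def coeff_pCons numeral_eq_Suc split: nat.split)
  define q where "q = coeff Q n"
  have "hsym 0 (-3) (-2) n \<noteq> (0 :: int)"
  proof
    assume "hsym 0 (-3) (-2) n = (0 :: int)"
    then have "4 * (-2) ^ n = - (5 + 3 * int n)" using hsym_112[of n] by simp
    then have "\<bar>4 * (-2) ^ n\<bar> = \<bar>5 + 3 * int n\<bar>" by (metis abs_minus_cancel)
    then have "4 * 2 ^ n = 5 + 3 * int n" by (simp add: abs_mult power_abs)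
    moreover have "4 * 2 ^ n > 5 + 3 * int n"
      using assms by (induction n rule: dec_induct) simp_all
    ultimately show False by simp
  qed
  moreover have "q = of_int (hsym 0 (-3) (-2) n)"
    using dQ by (simp add: q_def of_int_hsym)
  ultimately have "q \<noteq> 0" by simp
  then have deg: "degree Q = n"
    using dQ le_degree[of Q n] by (simp add: q_def)
  \<comment> \<open>\<open>Q\<close> prescribes the double root; \<open>R\<close> prescribes the
    simple root \<open>x\<close>, the other two both being \<open>(\<beta> - x) / 2\<close>. The
    factor -1/2 in this substitution makes the leading coefficients of \<open>Q\<close> and
    \<open>R\<close> differ.\<close>
  define R where "R = Q \<circ>\<^sub>p [:\<beta> / 2, - (1 / 2):]"
  have R: "poly R x = poly Q ((\<beta> - x) / 2)" for x
    by (simp add: R_def poly_pcompose diff_divide_distrib)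
  have "degree R = n" by (simp add: R_def degree_pcompose deg)
  then have "coeff R n = q * (-1/2) ^ n"
    using lead_coeff_comp[of "[:\<beta> / 2, - (1 / 2):]" Q] deg by (simp add: R_def q_def)
  then have "coeff (Q - R) n = q * (1 - (-1/2) ^ n)" by (simp add: q_def algebra_simps)
  moreover have "(-1/2 :: complex) ^ n \<noteq> 1"
  proof
    assume "(-1/2 :: complex) ^ n = 1"
    then have "norm ((-1/2 :: complex) ^ n) = 1" by simp
    then have "(1/2 :: real) ^ n = 1" by (simp add: norm_power norm_divide power_divide)
    moreover have "(1/2 :: real) ^ n < 1" using power_Suc_less_one[of "1/2 :: real" "n - 1"] assms
      by simp
    ultimately show False by simp
  qed
  ultimately have "coeff (Q - R) n \<noteq> 0" using \<open>q \<noteq> 0\<close> by simp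
  then have "Q - R \<noteq> 0" by auto
  moreover have "degree Q \<noteq> degree [:v:]" "degree R \<noteq> degree [:v:]"
    using \<open>degree R = n\<close> deg assms by simp_all
  then have "Q \<noteq> [:v:]" "R \<noteq> [:v:]" by blast+
  ultimately have "Q - R \<noteq> 0" "Q - [:v:] \<noteq> 0" "R - [:v:] \<noteq> 0" by simp_all
  then have "finite ({u. poly (Q - R) u = 0} \<union> {u. poly (Q - [:v:]) u = 0}
    \<union> {u. poly (R - [:v:]) u = 0})"
    using poly_roots_finite by blast
  then obtain r where r: "poly Q r \<noteq> poly R r" "poly Q r \<noteq> v" "poly R r \<noteq> v"
    by (rule finite_complex_avoid) auto
  define F where "F = hsym [:\<beta>:] [:r * (\<beta> - r), 1:] [:0, r:] n"
  have F: "poly F k = hsym \<beta> (r * (\<beta> - r) + k) (r * k) n" for k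
    by (simp add: F_def poly_hsym mult.commute)
  have F1: "poly F (r * (\<beta> - 2 * r)) = poly Q r"
    unfolding F Q by (intro arg_cong2[where f="\<lambda>a b. hsym \<beta> a b n"]) (simp_all add: algebra_simps
      power2_eq_square)
  have F2: "poly F (((\<beta> - r) / 2)\<^sup>2) = poly R r"
    unfolding F Q R by (intro arg_cong2[where f="\<lambda>a b. hsym \<beta> a b n"])
      (simp_all add: field_simps power2_eq_square)
  have "\<not> constant (poly (F - [:v:]))"
    using r(1) unfolding F1[symmetric] F2[symmetric] constant_def by auto
  then obtain k where "poly F k = v"
    using fundamental_theorem_of_algebra by force
  obtain y z where yz: "\<beta> - r = y + z" "k = y * z"
    by (rule quadratic_roots)
  have \<beta>: "\<beta> = r + y + z" using yz(1) by (simp add: algebra_simps)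
  have "y \<noteq> z"
  proof
    assume "y = z"
    then have "k = ((\<beta> - r) / 2)\<^sup>2" using yz by (simp add: power2_eq_square)
    then show False using F2 r \<open>poly F k = v\<close> by simp
  qed
  moreover have "r \<noteq> x" if "{x, w} = {y, z}" for x w
  proof
    assume "r = x"
    then have "k = r * (\<beta> - 2 * r)" using yz that
      by (auto simp: doubleton_eq_iff algebra_simps)
    then show False using F1 r \<open>poly F k = v\<close> by simp
  qed
  ultimately have "distinct [r, y, z]" by (auto simp: insert_commute)
  moreover have "hsym (r + y + z) (r*y + y*z + z*r) (r*y*z) n = v"
  proof -
    have "r * (\<beta> - r) + k = r*y + y*z + z*r" "r * k = r*y*z"
      using yz by (simp_all add: algebra_simps)
    then show ?thesis using \<open>poly F k = v\<close> \<beta> F by metis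
  qed
  ultimately show ?thesis using that \<beta> by blast
qed

section \<open>Decompositions into three terms\<close>

definition three_secant :: "nat \<Rightarrow> (nat \<Rightarrow> complex) \<Rightarrow> complex \<Rightarrow> bool" where
  "three_secant d a b \<longleftrightarrow> (\<exists>x y z c1 c2 c3.
     (\<forall>k<4. a k = c1 * x ^ k + c2 * y ^ k + c3 * z ^ k) \<and>
     b = c1 * x ^ d + c2 * y ^ d + c3 * z ^ d)"

definition two_secant :: "(nat \<Rightarrow> complex) \<Rightarrow> bool" where
  "two_secant a \<longleftrightarrow> (\<exists>x y c1 c2. \<forall>k<4. a k = c1 * x ^ k + c2 * y ^ k)"

lemma all_less_4: "(\<forall>k<4. P k) \<longleftrightarrow> P 0 \<and> P 1 \<and> P 2 \<and> P (3::nat)"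
  by (auto simp: numeral_eq_Suc less_Suc_eq)

text \<open>The hypotheses say that \<open>q0 + q1 T + q2 T^2\<close> annihilates the sequence.
  Dividing by \<open>q2\<close> turns it into a recurrence of order 2 whose characteristic roots are
  the roots of this polynomial.\<close>

lemma apolar_roots:
  fixes a :: "nat \<Rightarrow> complex"
  assumes "q2 \<noteq> 0" "q0 * a 0 + q1 * a 1 + q2 * a 2 = 0" "q0 * a 1 + q1 * a 2 + q2 * a 3 = 0"
  obtains x y where "- q1 = (x + y) * q2" "q0 = x * y * q2"
    "a 2 = (x + y) * a 1 - x * y * a 0" "a 3 = (x + y) * a 2 - x * y * a 1"
proof -
  obtain x y where xy: "- (q1 / q2) = x + y" "q0 / q2 = x * y" by (rule quadratic_roots)
  have q: "- q1 = (x + y) * q2" "q0 = x * y * q2"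
    unfolding xy[symmetric] using assms(1) by simp_all
  have q1: "q1 = - ((x + y) * q2)" using q(1) by (metis minus_minus)
  have "q2 * (x * y * a 0 - (x + y) * a 1 + a 2) = q0 * a 0 + q1 * a 1 + q2 * a 2"
    "q2 * (x * y * a 1 - (x + y) * a 2 + a 3) = q0 * a 1 + q1 * a 2 + q2 * a 3"
    unfolding q1 q(2) by (simp_all add: algebra_simps)
  then have z: "x * y * a 0 - (x + y) * a 1 + a 2 = 0" "x * y * a 1 - (x + y) * a 2 + a 3 = 0"
    using assms by simp_all
  have "a 2 = (x + y) * a 1 - x * y * a 0 + (x * y * a 0 - (x + y) * a 1 + a 2)"
    "a 3 = (x + y) * a 2 - x * y * a 1 + (x * y * a 1 - (x + y) * a 2 + a 3)"
    by simp_all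
  then have "a 2 = (x + y) * a 1 - x * y * a 0" "a 3 = (x + y) * a 2 - x * y * a 1"
    unfolding z by simp_all
  with q show ?thesis by (rule that)
qed

lemma two_secant_of_roots:
  fixes a :: "nat \<Rightarrow> complex"
  assumes "x \<noteq> y" "a 2 = (x + y) * a 1 - x * y * a 0" "a 3 = (x + y) * a 2 - x * y * a 1"
  shows "\<exists>c1 c2. \<forall>k<4. a k = c1 * x ^ k + c2 * y ^ k"
proof -
  define c1 c2 where "c1 = (a 1 - y * a 0) / (x - y)" and "c2 = (x * a 0 - a 1) / (x - y)"
  have 0: "a 0 = c1 + c2" "a 1 = c1 * x + c2 * y"
    using assms(1) by (simp_all add: c1_def c2_def divide_simps) (simp_all add: algebra_simps)
  have 2: "a 2 = c1 * x\<^sup>2 + c2 * y\<^sup>2"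
    unfolding assms(2) 0 by (simp add: algebra_simps power2_eq_square)
  have "a 3 = c1 * x ^ 3 + c2 * y ^ 3"
    unfolding assms(3) 0 2 by (simp add: algebra_simps power2_eq_square power3_eq_cube)
  with 0 2 show ?thesis unfolding all_less_4
    by (intro exI[of _ c1] exI[of _ c2]) simp
qed

lemma shifted_low_powers:
  fixes x y z c1 c2 c3 t :: complex
  shows "c1 * (t + x) ^ 0 + c2 * (t + y) ^ 0 + c3 * (t + z) ^ 0 = c1 + c2 + c3"
    and "c1 * (t + x) ^ 1 + c2 * (t + y) ^ 1 + c3 * (t + z) ^ 1 =
      t * (c1 + c2 + c3) + (c1 * x + c2 * y + c3 * z)"
    and "c1 * (t + x)\<^sup>2 + c2 * (t + y)\<^sup>2 + c3 * (t + z)\<^sup>2 =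
      t\<^sup>2 * (c1 + c2 + c3) + 2 * t * (c1 * x + c2 * y + c3 * z)
      + (c1 * x\<^sup>2 + c2 * y\<^sup>2 + c3 * z\<^sup>2)"
    and "c1 * (t + x) ^ 3 + c2 * (t + y) ^ 3 + c3 * (t + z) ^ 3 =
      t ^ 3 * (c1 + c2 + c3) + 3 * t\<^sup>2 * (c1 * x + c2 * y + c3 * z)
      + 3 * t * (c1 * x\<^sup>2 + c2 * y\<^sup>2 + c3 * z\<^sup>2) + (c1 * x ^ 3 + c2 * y ^ 3 + c3 * z ^ 3)"
  by (simp_all add: algebra_simps power2_eq_square power3_eq_cube)

section \<open>The three positions off the proper secants\<close>

text \<open>The recurrence with double root \<open>t\<close> becomes, after translation by
  \<open>t\<close>, the vanishing of terms 2 and 3; \<open>a 1 \<noteq> t * a 0\<close> keeps the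
  point off the twisted cubic.\<close>

lemma three_secant_of_tangent:
  assumes "d \<ge> 5" "a 1 \<noteq> t * a 0"
    "a 2 = 2 * t * a 1 - t\<^sup>2 * a 0" "a 3 = 2 * t * a 2 - t\<^sup>2 * a 1"
  shows "three_secant d a b"
proof -
  define s where "s = a 1 - t * a 0"
  have s: "s \<noteq> 0" using assms(2) by (simp add: s_def)
  obtain x y z where xyz: "distinct [x, y, z]" "x*y + y*z + z*x = a 0 / s * (x*y*z)"
    "x*y*z * hsum t 4 d (x + y + z) (x*y + y*z + z*x) (x*y*z)
      = (b - t ^ d * a 0 - of_nat d * t ^ (d - 1) * s) / s"
    using tangent_squarefree[OF assms(1)] by metis
  obtain c1 c2 c3 where c: "c1 + c2 + c3 = a 0" "c1 * x + c2 * y + c3 * z = s"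
    "c1 * x\<^sup>2 + c2 * y\<^sup>2 + c3 * z\<^sup>2 = 0"
    using vandermonde3[OF xyz(1)] by metis
  have e2: "(x*y + y*z + z*x) * s = a 0 * (x*y*z)" using xyz(2) s by simp
  \<comment> \<open>The weights were fitted to terms 0, 1, 2 only. Term 3 follows from the
    recurrence, where the chosen relation between the symmetric functions cancels it; likewise term
    4 is \<open>x*y*z * s\<close>.\<close>
  have c3: "c1 * x ^ 3 + c2 * y ^ 3 + c3 * z ^ 3 = 0"
  proof -
    have "c1 * x ^ 3 + c2 * y ^ 3 + c3 * z ^ 3 = (x + y + z) * (c1 * x\<^sup>2 + c2 * y\<^sup>2 + c3 * z\<^sup>2)
        - (x*y + y*z + z*x) * (c1 * x + c2 * y + c3 * z) + x*y*z * (c1 + c2 + c3)"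
      by (simp add: algebra_simps power2_eq_square power3_eq_cube)
    then show ?thesis using c e2 by simp
  qed
  have c4: "c1 * x ^ 4 + c2 * y ^ 4 + c3 * z ^ 4 = x*y*z * s"
  proof -
    have "c1 * x ^ 4 + c2 * y ^ 4 + c3 * z ^ 4
        = (x + y + z) * (c1 * x ^ 3 + c2 * y ^ 3 + c3 * z ^ 3)
        - (x*y + y*z + z*x) * (c1 * x\<^sup>2 + c2 * y\<^sup>2 + c3 * z\<^sup>2)
        + x*y*z * (c1 * x + c2 * y + c3 * z)"
      by (simp add: algebra_simps eval_nat_numeral)
    then show ?thesis using c c3 by simp
  qed
  have "c1 * (t + x) ^ d + c2 * (t + y) ^ d + c3 * (t + z) ^ d = b"
  proof -
    have "c1 * (t + x) ^ d + c2 * (t + y) ^ d + c3 * (t + z) ^ d =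
        (\<Sum>k<2. of_nat (d choose k) * t ^ (d - k) * (c1 * x ^ k + c2 * y ^ k + c3 * z ^ k))
        + x*y*z * s * hsum t 4 d (x + y + z) (x*y + y*z + z*x) (x*y*z)"
      using shifted_power_sum_hsum[of c1 x 2 c2 y c3 z d t] c(3) c3 c4 assms(1)
      by (simp add: numeral_eq_Suc)
    also have "\<dots> = t ^ d * a 0 + of_nat d * t ^ (d - 1) * s + s * (x*y*z * hsum t 4 d (x + y
      + z) (x*y + y*z + z*x) (x*y*z))"
      using c by (simp add: numeral_2_eq_2)
    also have "\<dots> = b" using s by (simp add: xyz(3))
    finally show ?thesis .
  qed
  moreover have "\<forall>k<4. a k = c1 * (t + x) ^ k + c2 * (t + y) ^ k + c3 * (t + z) ^ k"
    unfolding all_less_4 shifted_low_powers c c3 assms(4) assms(3)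
    by (simp add: s_def algebra_simps power2_eq_square power3_eq_cube)
  ultimately show ?thesis unfolding three_secant_def by blast
qed

text \<open>After translation by \<open>t\<close> the terms are \<open>a 0, 0, 0, s\<close>, so
  admissibility is the single condition \<open>x*y*z = s / a 0\<close>.\<close>

lemma three_secant_of_secant_infinity:
  assumes "d \<ge> 4" "a 0 \<noteq> 0" "a 1 = t * a 0" "a 2 = t * a 1" "a 3 \<noteq> t * a 2"
  shows "three_secant d a b"
proof -
  define s where "s = a 3 - t * a 2"
  have s: "s \<noteq> 0" using assms(5) by (simp add: s_def)
  obtain x y z where xyz: "distinct [x, y, z]" "x*y*z = s / a 0"
    "hsum t 3 d (x + y + z) (x*y + y*z + z*x) (x*y*z) = (b - t ^ d * a 0) / s"
    using secant_infinity_squarefree[OF assms(1), of "s / a 0"] s assms(2)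
    by (metis divide_eq_0_iff)
  obtain c1 c2 c3 where c: "c1 + c2 + c3 = a 0" "c1 * x + c2 * y + c3 * z = 0"
    "c1 * x\<^sup>2 + c2 * y\<^sup>2 + c3 * z\<^sup>2 = 0"
    using vandermonde3[OF xyz(1)] by metis
  have c3: "c1 * x ^ 3 + c2 * y ^ 3 + c3 * z ^ 3 = s"
  proof -
    have "c1 * x ^ 3 + c2 * y ^ 3 + c3 * z ^ 3 = (x + y + z) * (c1 * x\<^sup>2 + c2 * y\<^sup>2 + c3 * z\<^sup>2)
        - (x*y + y*z + z*x) * (c1 * x + c2 * y + c3 * z) + x*y*z * (c1 + c2 + c3)"
      by (simp add: algebra_simps power2_eq_square power3_eq_cube)
    then show ?thesis using c xyz(2) assms(2) by simp
  qed
  have "c1 * (t + x) ^ d + c2 * (t + y) ^ d + c3 * (t + z) ^ d = b"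
  proof -
    have "c1 * (t + x) ^ d + c2 * (t + y) ^ d + c3 * (t + z) ^ d =
        t ^ d * a 0 + s * hsum t 3 d (x + y + z) (x*y + y*z + z*x) (x*y*z)"
      using shifted_power_sum_hsum[of c1 x 1 c2 y c3 z d t] c c3 assms(1)
      by (simp add: numeral_eq_Suc)
    also have "\<dots> = b" using s by (simp add: xyz(3))
    finally show ?thesis .
  qed
  moreover have "\<forall>k<4. a k = c1 * (t + x) ^ k + c2 * (t + y) ^ k + c3 * (t + z) ^ k"
    unfolding all_less_4 shifted_low_powers c c3 using assms(3,4)
    by (simp add: s_def algebra_simps power2_eq_square power3_eq_cube)
  ultimately show ?thesis unfolding three_secant_def by blast
qed

text \<open>The zeros already stand at indices 0 and 1, so no translation is made; term 3 is
  \<open>a 2\<close> times the sum of the roots, which fixes that sum.\<close>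

lemma three_secant_of_tangent_infinity:
  assumes "d \<ge> 5" "a 0 = 0" "a 1 = 0" "a 2 \<noteq> 0"
  shows "three_secant d a b"
proof -
  obtain x y z where xyz: "distinct [x, y, z]" "x + y + z = a 3 / a 2"
    "hsym (x + y + z) (x*y + y*z + z*x) (x*y*z) (d - 2) = b / a 2"
    by (rule tangent_infinity_squarefree[of "d - 2" "a 3 / a 2" "b / a 2"]) (use assms(1) in auto)
  obtain c1 c2 c3 where c: "c1 + c2 + c3 = 0" "c1 * x + c2 * y + c3 * z = 0"
    "c1 * x\<^sup>2 + c2 * y\<^sup>2 + c3 * z\<^sup>2 = a 2"
    using vandermonde3[OF xyz(1)] by metis
  have p: "c1 * x ^ k + c2 * y ^ k + c3 * z ^ k =
      a 2 * hsym (x + y + z) (x*y + y*z + z*x) (x*y*z) (k - 2)" if k: "k \<ge> 2" for k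
  proof -
    obtain i where "k = Suc (Suc 0) + i" using le_Suc_ex[OF k] by auto
    then show ?thesis using power_sum_hsym[of c1 x 0 c2 y c3 z i] c by (simp add: power2_eq_square)
  qed
  have "b = c1 * x ^ d + c2 * y ^ d + c3 * z ^ d" using p[of d] assms xyz(3) by simp
  moreover have "\<forall>k<4. a k = c1 * x ^ k + c2 * y ^ k + c3 * z ^ k"
    unfolding all_less_4 using p[of 3] c assms xyz(2) by simp
  ultimately show ?thesis unfolding three_secant_def by blast
qed

lemma two_secant_geometric:
  assumes "a 1 = t * a 0" "a 2 = t * a 1" "a 3 = t * a 2"
  shows "two_secant a"
  unfolding two_secant_def all_less_4 using assms
  by (intro exI[of _ t] exI[of _ t] exI[of _ "a 0"] exI[of _ 0])
    (simp add: power2_eq_square power3_eq_cube)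

text \<open>The cases follow the roots of the apolar quadratic form: both finite, one at infinity,
  both at infinity, or the zero form, where the point lies on the twisted cubic.\<close>

lemma secant_cases:
  assumes "d \<ge> 5" "\<not> (a 0 = 0 \<and> a 1 = 0 \<and> a 2 = 0)"
  shows "two_secant a \<or> three_secant d a b"
proof -
  \<comment> \<open>The cross product of \<open>(a 0, a 1, a 2)\<close> and
    \<open>(a 1, a 2, a 3)\<close>, hence orthogonal to both.\<close>
  define q0 q1 q2 where "q0 = a 1 * a 3 - (a 2)\<^sup>2" and "q1 = a 1 * a 2 - a 0 * a 3"
    and "q2 = a 0 * a 2 - (a 1)\<^sup>2"
  have apolar: "q0 * a 0 + q1 * a 1 + q2 * a 2 = 0" "q0 * a 1 + q1 * a 2 + q2 * a 3 = 0"
    by (simp_all add: q0_def q1_def q2_def algebra_simps power2_eq_square)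
  consider (quadratic) "q2 \<noteq> 0" | (linear) "q2 = 0" "q1 \<noteq> 0" | (const) "q2 = 0" "q1 = 0" "q0 \<noteq> 0"
    | (zero) "q2 = 0" "q1 = 0" "q0 = 0" by blast
  then show ?thesis
  proof cases
    case quadratic
    then obtain x y where r: "a 2 = (x + y) * a 1 - x * y * a 0" "a 3 = (x + y) * a 2 - x * y * a 1"
      by (rule apolar_roots[OF _ apolar])
    show ?thesis
    proof (cases "x = y")
      case True
      show ?thesis
      proof (cases "a 1 = x * a 0")
        case True
        with \<open>x = y\<close> r show ?thesis
          by (intro disjI1 two_secant_geometric[of a x]) (simp_all add: algebra_simps)
      next
        case False
        with \<open>x = y\<close> r assms(1) show ?thesis
          by (intro disjI2 three_secant_of_tangent[of d a x]) (simp_all add: algebra_simps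
            power2_eq_square)
      qed
    qed (use two_secant_of_roots[OF _ r] two_secant_def in blast)
  next
    case linear
    define t where "t = - q0 / q1"
    have t: "a 1 = t * a 0" "a 2 = t * a 1"
      using apolar linear by (simp_all add: t_def divide_simps add_eq_0_iff2 mult.commute)
    then have "a 0 \<noteq> 0" using assms(2) by auto
    have d: "d \<ge> 4" using assms(1) by simp
    show ?thesis
    proof (cases "a 3 = t * a 2")
      case True
      show ?thesis using two_secant_geometric[OF t True] by blast
    next
      case False
      show ?thesis using three_secant_of_secant_infinity[OF d \<open>a 0 \<noteq> 0\<close> t False] by blast
    qed
  next
    case const
    then have "a 0 = 0" "a 1 = 0" using apolar by simp_all
    then show ?thesis using three_secant_of_tangent_infinity assms by blast
  next
    case zero
    have "a 0 \<noteq> 0"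
    proof
      assume "a 0 = 0"
      then have "a 1 = 0" using zero by (simp add: q2_def)
      then have "a 2 = 0" using zero by (simp add: q0_def)
      then show False using assms(2) \<open>a 0 = 0\<close> \<open>a 1 = 0\<close> by blast
    qed
    define t where "t = a 1 / a 0"
    have 1: "a 1 = t * a 0" using \<open>a 0 \<noteq> 0\<close> by (simp add: t_def)
    have "a 0 * (a 2 - t * a 1) = 0" using zero(1) 1
      by (simp add: q2_def algebra_simps power2_eq_square)
    then have 2: "a 2 = t * a 1" using \<open>a 0 \<noteq> 0\<close> by simp
    have "a 0 * (a 3 - t * a 2) = 0" using zero(2) 1 by (auto simp: q1_def algebra_simps)
    then have "a 3 = t * a 2" using \<open>a 0 \<noteq> 0\<close> by simp
    with 1 2 have "two_secant a" by (rule two_secant_geometric)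
    then show ?thesis by blast
  qed
qed

section \<open>Projective points and closed sets\<close>

lemma exhaust_5: "x = 0 \<or> x = 1 \<or> x = 2 \<or> x = 3 \<or> x = (4::5)"
proof (induct x)
  case (of_int z)
  then have "z = 0 \<or> z = 1 \<or> z = 2 \<or> z = 3 \<or> z = 4" by fastforce
  then show ?case by auto
qed

lemma UNIV_5: "UNIV = {0, 1, 2, 3, 4 :: 5}"
  using exhaust_5 by auto

lemma sum_5: "sum f (UNIV :: 5 set) = f 0 + f 1 + f 2 + f 3 + f 4"
  unfolding UNIV_5 by (simp add: ac_simps)

lemma all_5: "(\<forall>i::5. P i) \<longleftrightarrow> P 0 \<and> P 1 \<and> P 2 \<and> P 3 \<and> P 4"
  using exhaust_5 by metis

definition vec5 :: "'a \<Rightarrow> 'a \<Rightarrow> 'a \<Rightarrow> 'a \<Rightarrow> 'a \<Rightarrow> 'a ^ 5" where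
  "vec5 a b c d e = (\<chi> i. if i = 0 then a else if i = 1 then b else if i = 2 then c
     else if i = 3 then d else e)"

lemma vec5_nth [simp]:
  "vec5 a b c d e $ 0 = a" "vec5 a b c d e $ 1 = b" "vec5 a b c d e $ 2 = c"
  "vec5 a b c d e $ 3 = d" "vec5 a b c d e $ 4 = e"
  by (simp_all add: vec5_def)

lemma vec5_eq_iff: "v = w \<longleftrightarrow> v $ 0 = w $ 0 \<and> v $ 1 = w $ 1 \<and> v $ 2 = w $ 2 \<and> v $ 3 = w $ 3
  \<and> v $ 4 = w $ (4::5)"
  by (simp add: vec_eq_iff all_5)

definition pt :: "complex ^ 'n::finite \<Rightarrow> 'n proj" where
  "pt v = Abs_proj (vec.span {v})"

lemma line_of_pt: "v \<noteq> 0 \<Longrightarrow> line_of (pt v) = vec.span {v}"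
  unfolding pt_def by (rule Abs_proj_inverse) blast

lemma pt_cases:
  obtains v where "v \<noteq> 0" "p = pt v"
  using line_of_span[of p] by (metis line_of_inverse pt_def)

lemma pt_scale: "c \<noteq> 0 \<Longrightarrow> pt (c *s v) = pt v"
proof -
  assume "c \<noteq> 0"
  then have "vec.span {c *s v} = vec.span {v}"
    by (intro vec.span_eq[THEN iffD2]) (auto simp: vec.span_singleton intro: exI[of _
      "1 / c"] image_eqI[of _ _ "1 / c"])
  then show ?thesis by (simp add: pt_def)
qed

lemma pt_eq_iff:
  assumes "v \<noteq> 0" "w \<noteq> 0"
  shows "pt v = pt w \<longleftrightarrow> (\<exists>c. c \<noteq> 0 \<and> v = c *s w)"
proof
  assume "pt v = pt w"
  then have "v \<in> vec.span {w}"
    using line_of_pt[OF assms(1)] line_of_pt[OF assms(2)] vec.span_base[of v "{v}"] by auto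
  then obtain c where "v = c *s w" by (auto simp: vec.span_singleton)
  with assms(1) show "\<exists>c. c \<noteq> 0 \<and> v = c *s w" by auto
qed (auto simp: pt_scale)

text \<open>The zero vector is excluded because \<open>pt 0\<close> is an unspecified point.\<close>

lemma pt_in_proj_span:
  assumes "v \<noteq> 0" "0 \<notin> V"
  shows "pt v \<in> proj_span (pt ` V) \<longleftrightarrow> v \<in> vec.span V"
proof -
  have "(\<Union>q\<in>pt ` V. line_of q) = (\<Union>w\<in>V. vec.span {w})"
    using assms(2) by (auto simp: line_of_pt) (metis line_of_pt)+
  moreover have "vec.span (\<Union>w\<in>V. vec.span {w}) = vec.span V"
  proof (rule vec.span_eq[THEN iffD2], intro conjI subsetI)
    fix x assume "x \<in> (\<Union>w\<in>V. vec.span {w})"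
    then show "x \<in> vec.span V" using vec.span_mono by blast
  next
    fix x assume "x \<in> V"
    then show "x \<in> vec.span (\<Union>w\<in>V. vec.span {w})"
      by (intro vec.span_base) (auto intro: vec.span_base)
  qed
  ultimately show ?thesis
    using assms(1) vec.span_minimal[of "{v}" "vec.span V"] vec.span_base[of v "{v}"]
    by (auto simp: proj_span_def line_of_pt)
qed

lemma pt_in_proj_zeros:
  assumes "\<forall>F\<in>S. \<exists>k. homogeneous k F" "v \<noteq> 0"
  shows "pt v \<in> proj_zeros S \<longleftrightarrow> (\<forall>F\<in>S. peval F v = 0)"
  using proj_zeros_homogeneous_iff[OF _ assms(2)] assms(1)
  unfolding proj_zeros_def by (simp add: line_of_pt[OF assms(2)] vec.span_base) (metis insertI1
    vec.span_base line_of_pt[OF assms(2)])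

lemma closedin_proj_zeros:
  "\<forall>F\<in>S. \<exists>k. homogeneous k F \<Longrightarrow> closedin zariski (proj_zeros S)"
  by (auto simp: closedin_zariski algebraic_set_def)

abbreviation coord :: "'n::finite \<Rightarrow> 'n mpoly" where
  "coord i \<equiv> Poly_Mapping.single (Poly_Mapping.single i 1) 1"

lemma mono_eval_single [simp]: "mono_eval (Poly_Mapping.single i k) v = v $ i ^ k"
proof -
  have "mono_eval (Poly_Mapping.single i k) v = (\<Prod>j\<in>{i}. v $ j ^ k)"
    unfolding mono_eval_def by (rule prod.mono_neutral_cong_right) (auto simp: lookup_single)
  then show ?thesis by simp
qed

lemma homogeneous_single: "homogeneous k (Poly_Mapping.single m c)"
  if "(\<Sum>i\<in>UNIV. Poly_Mapping.lookup m i) = k"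
  using that by (simp add: homogeneous_def)

lemma homogeneous_coord: "homogeneous 1 (coord i)"
  by (rule homogeneous_single) (simp add: lookup_single when_def)

lemma homogeneous_add:
  "homogeneous k F \<Longrightarrow> homogeneous k G \<Longrightarrow> homogeneous k (F + G)"
  unfolding homogeneous_def using Poly_Mapping.keys_add[of F G] by blast

lemma homogeneous_uminus: "homogeneous k F \<Longrightarrow> homogeneous k (- F)"
  by (simp add: homogeneous_def)

lemma homogeneous_diff:
  "homogeneous k F \<Longrightarrow> homogeneous k G \<Longrightarrow> homogeneous k (F - G)"
  using homogeneous_add[OF _ homogeneous_uminus, of k F G] by simp

lemma homogeneous_power: "homogeneous k F \<Longrightarrow> homogeneous (k * n) (F ^ n)"
  by (induction n) (auto simp: homogeneous_mult, simp add: homogeneous_def)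

lemma homogeneous_const: "homogeneous 0 (Poly_Mapping.single 0 c)"
  by (rule homogeneous_single) simp

lemma homogeneous_scale: "homogeneous k F \<Longrightarrow> homogeneous k (Poly_Mapping.single 0 c * F)"
  using homogeneous_mult[OF homogeneous_const, of k F c] by simp

lemma peval_uminus: "peval (- F) v = - peval F v"
  using peval_add[of "- F" F v] by (simp add: eq_neg_iff_add_eq_0)

lemma peval_diff: "peval (F - G) v = peval F v - peval G v"
  using peval_add[of F "- G" v] by (simp add: peval_uminus)

lemma peval_power: "peval (F ^ n) v = peval F v ^ n"
  by (induction n) (simp_all add: peval_mult)

lemma closedin_point: "closedin zariski {p}"
proof -
  obtain v where v: "v \<noteq> 0" "p = pt v" by (rule pt_cases)
  \<comment> \<open>The 2 by 2 minors of the matrix with rows \<open>v\<close> and the coordinate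
    vector.\<close>
  define F where "F = (\<lambda>(i, j). Poly_Mapping.single 0 (v $ i) * coord j
    - Poly_Mapping.single 0 (v $ j) * coord i)"
  have S: "\<forall>G\<in>range F. \<exists>k. homogeneous k G"
  proof -
    have "homogeneous 1 (F (i, j))" for i j
      unfolding F_def prod.case by (intro homogeneous_diff homogeneous_scale homogeneous_coord)
    then show ?thesis by auto
  qed
  have ev: "peval (F (i, j)) w = v $ i * w $ j - v $ j * w $ i" for i j w
    by (simp add: F_def peval_diff peval_mult)
  have "q \<in> proj_zeros (range F) \<longleftrightarrow> q = p" for q
  proof -
    obtain w where w: "w \<noteq> 0" "q = pt w" by (rule pt_cases)
    have "q \<in> proj_zeros (range F) \<longleftrightarrow> (\<forall>i j. v $ i * w $ j = v $ j * w $ i)"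
      unfolding w(2) pt_in_proj_zeros[OF S w(1)] by (simp add: ev)
    also have "\<dots> \<longleftrightarrow> (\<exists>c. c \<noteq> 0 \<and> w = c *s v)"
    proof
      assume *: "\<forall>i j. v $ i * w $ j = v $ j * w $ i"
      obtain i where i: "v $ i \<noteq> 0" using v(1) by (auto simp: vec_eq_iff)
      then have c: "w = (w $ i / v $ i) *s v"
        using * by (simp add: vec_eq_iff field_simps)
      moreover from c have "w $ i / v $ i \<noteq> 0" using w(1) by (metis vector_smult_lzero)
      ultimately show "\<exists>c. c \<noteq> 0 \<and> w = c *s v" by blast
    next
      assume "\<exists>c. c \<noteq> 0 \<and> w = c *s v"
      then obtain c where "w = c *s v" by blast
      then show "\<forall>i j. v $ i * w $ j = v $ j * w $ i" by simp
    qed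
    also have "\<dots> \<longleftrightarrow> q = p" unfolding w(2) v(2) pt_eq_iff[OF w(1) v(1)] ..
    finally show ?thesis .
  qed
  then have "proj_zeros (range F) = {p}" by blast
  then show ?thesis using closedin_proj_zeros[OF S] by simp
qed

section \<open>Dimension from finiteness of proper closed subsets\<close>

lemma closedin_finite: "finite A \<Longrightarrow> closedin zariski A"
proof (induction rule: finite_induct)
  case (insert x A)
  then show ?case using closedin_Un[OF closedin_point[of x]] by simp
qed simp

text \<open>In a chain of length 2 the middle set would be a proper closed subset of
  \<open>C\<close>, hence finite; but a finite irreducible set is a single point and contains no
  smaller nonempty set.\<close>

lemma zdim_le_1:
  assumes "closedin zariski W" "W \<subseteq> C" "\<And>Z. closedin zariski Z \<Longrightarrow> Z \<subseteq> C \<Longrightarrow> Z = C \<or> finite Z"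
  shows "zdim W \<le> 1"
  unfolding zdim_def krull_dim_def
proof (rule Sup_least, clarify)
  let ?T = "subtopology zariski W"
  fix n :: nat and Z :: "nat \<Rightarrow> 'a proj set"
  assume Z: "\<forall>i\<le>n. closedin ?T (Z i) \<and> irreducible_in ?T (Z i)" "\<forall>i<n. Z i \<subset> Z (Suc i)"
  have "n \<le> 1"
  proof (rule ccontr)
    assume "\<not> n \<le> 1"
    then have n: "n \<ge> 2" by simp
    have c: "closedin zariski (Z i)" "Z i \<subseteq> W" if "i \<le> n" for i
      using Z(1) that assms(1) closedin_trans_full closedin_subset by fastforce+
    have 12: "Z 0 \<subset> Z 1" "Z 1 \<subset> Z 2" using Z(2) n by (auto simp: numeral_2_eq_2)
    have "Z 2 \<subseteq> C" using c(2)[of 2] n assms(2) by auto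
    with 12 have "finite (Z 1)" using assms(3)[of "Z 1"] c(1)[of 1] n by auto
    have ne: "Z 0 \<noteq> {}" using Z(1) by (auto simp: irreducible_in_def)
    then obtain x where x: "x \<in> Z 0" by blast
    have cl: "closedin ?T A" if "finite A" "A \<subseteq> W" for A
      using closedin_finite[OF that(1)] that(2) closedin_subset_topspace by blast
    have "x \<in> W" using x c(2)[of 0] by auto
    then have "closedin ?T {x}" "closedin ?T (Z 1 - {x})"
      using cl \<open>finite (Z 1)\<close> c(2)[of 1] n by auto
    moreover have "irreducible_in ?T (Z 1)" using Z(1) n by auto
    moreover have "Z 1 \<subseteq> {x} \<union> (Z 1 - {x})" by blast
    ultimately have "Z 1 \<subseteq> {x} \<or> Z 1 \<subseteq> Z 1 - {x}"
      unfolding irreducible_in_def by blast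
    then show False using x 12 by blast
  qed
  then show "ereal (real n) \<le> 1" by (simp flip: one_ereal_def)
qed

text \<open>If two closed sets cover \<open>C\<close>, one of them meets \<open>C\<close> in
  infinitely many points and so contains it. A point inside \<open>C\<close> gives the chain of
  length 1.\<close>

lemma projective_curveI:
  assumes "closedin zariski C" "infinite C"
    "\<And>Z. closedin zariski Z \<Longrightarrow> Z \<subseteq> C \<Longrightarrow> Z = C \<or> finite Z"
  shows "projective_curve C"
proof -
  have irr: "irreducible_in zariski C"
    unfolding irreducible_in_def
  proof (intro conjI allI impI)
    fix A B assume *: "closedin zariski A \<and> closedin zariski B \<and> C \<subseteq> A \<union> B"
    then have "infinite (C \<inter> A) \<or> infinite (C \<inter> B)"
      using assms(2) by (metis Int_Un_distrib finite_UnI le_iff_inf)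
    then show "C \<subseteq> A \<or> C \<subseteq> B"
      using assms(3)[of "C \<inter> A"] assms(3)[of "C \<inter> B"] assms(1) *
        by (metis closedin_Int inf_le1 inf_le2)
  qed (use assms(2) in auto)
  obtain x where x: "x \<in> C" using assms(2) by fastforce
  let ?T = "subtopology zariski C"
  define Z where "Z = (\<lambda>i::nat. if i = 0 then {x} else C)"
  have cl: "closedin ?T {x}" "closedin ?T C"
    using closedin_point[of x] x assms(1) by (auto intro!: closedin_subset_topspace)
  have "irreducible_in ?T {x}" using x by (auto simp: irreducible_in_def)
  moreover have "irreducible_in ?T C"
    using irr closedin_trans_full[OF _ assms(1)] by (auto simp: irreducible_in_def)
  ultimately have "\<forall>i\<le>1. closedin ?T (Z i) \<and> irreducible_in ?T (Z i)" "\<forall>i<1. Z i \<subset> Z (Suc i)"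
    using cl x assms(2) by (auto simp: Z_def)
  then have "ereal (real 1) \<le> zdim C"
    unfolding zdim_def krull_dim_def by (intro Sup_upper) blast
  moreover have "zdim C \<le> 1" using zdim_le_1[OF assms(1) order_refl assms(3)] by blast
  ultimately show ?thesis using irr assms(1) by (simp add: projective_curve_def flip: one_ereal_def)
qed

lemma peval_poly:
  assumes "\<And>i. \<exists>p. \<forall>t. f t $ i = poly p t"
  shows "\<exists>P. \<forall>t. peval F (f t) = poly P t"
proof -
  obtain p where p: "\<And>i t. f t $ i = poly (p i) t" using assms by metis
  have "peval F (f t) = poly (\<Sum>m\<in>Poly_Mapping.keys F. Polynomial.smult (Poly_Mapping.lookup F m)
      (\<Prod>i\<in>UNIV. p i ^ Poly_Mapping.lookup m i)) t" for t
    by (simp add: peval_def mono_eval_def p poly_sum poly_prod poly_power)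
  then show ?thesis by blast
qed

text \<open>A form pulled back along \<open>f\<close> is a polynomial in one variable: either one of
  them is nonzero and has finitely many roots, or all vanish identically and the second chart
  \<open>g\<close> carries this to the missing point \<open>g 0\<close>.\<close>

lemma closed_subset_param:
  assumes f: "\<And>i. \<exists>p. \<forall>t. f t $ i = poly p t" "\<And>t. f t \<noteq> 0"
    and g: "\<And>i. \<exists>p. \<forall>t. g t $ i = poly p t" "\<And>t. g t \<noteq> 0"
    and fg: "\<And>t. t \<noteq> 0 \<Longrightarrow> pt (f t) = pt (g (1 / t))"
    and Z: "closedin zariski Z" "Z \<subseteq> insert (pt (g 0)) (range (\<lambda>t. pt (f t)))"
  shows "Z = insert (pt (g 0)) (range (\<lambda>t. pt (f t))) \<or> finite Z"
proof -
  obtain S where S: "\<forall>F\<in>S. \<exists>k. homogeneous k F" "Z = proj_zeros S"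
    using Z(1) by (auto simp: closedin_zariski algebraic_set_def)
  show ?thesis
  proof (cases "\<forall>F\<in>S. \<forall>t. peval F (f t) = 0")
    case True
    then have f0: "pt (f t) \<in> Z" for t unfolding S(2) pt_in_proj_zeros[OF S(1) f(2)] by blast
    have "peval F (g 0) = 0" if F: "F \<in> S" for F
    proof -
      obtain P where P: "\<And>t. peval F (g t) = poly P t" using peval_poly[of g F] g(1) by metis
      have "poly P s = 0" if "s \<noteq> 0" for s
      proof -
        have "pt (g s) \<in> Z" using fg[of "1 / s"] f0[of "1 / s"] that by simp
        then show ?thesis unfolding S(2) pt_in_proj_zeros[OF S(1) g(2)] using F P by metis
      qed
      then have "UNIV - {0} \<subseteq> {s. poly P s = 0}" by blast
      then have "infinite {s. poly P s = 0}"
        using infinite_UNIV_char_0 finite_subset by (metis finite_Diff2 finite.intros)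
      then have "P = 0" using poly_roots_finite by blast
      then show ?thesis using P by simp
    qed
    then have "pt (g 0) \<in> Z" unfolding S(2) pt_in_proj_zeros[OF S(1) g(2)] by blast
    with f0 Z(2) show ?thesis by blast
  next
    case False
    then obtain F t0 where F: "F \<in> S" "peval F (f t0) \<noteq> 0" by blast
    obtain P where P: "\<And>t. peval F (f t) = poly P t" using peval_poly[of f F] f(1) by metis
    have "P \<noteq> 0" using F P by auto
    have "Z \<subseteq> insert (pt (g 0)) ((\<lambda>t. pt (f t)) ` {t. poly P t = 0})"
    proof
      fix q assume q: "q \<in> Z"
      then consider "q = pt (g 0)" | t where "q = pt (f t)" using Z(2) by blast
      then show "q \<in> insert (pt (g 0)) ((\<lambda>t. pt (f t)) ` {t. poly P t = 0})"
      proof cases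
        case 2
        have "pt (f t) \<in> proj_zeros S" using q 2 S(2) by simp
        then have "poly P t = 0" unfolding pt_in_proj_zeros[OF S(1) f(2)] using F P by metis
        then show ?thesis using 2 by blast
      qed simp
    qed
    then show ?thesis using poly_roots_finite[OF \<open>P \<noteq> 0\<close>] finite_subset by blast
  qed
qed

section \<open>The curve\<close>

definition curve_vec :: "nat \<Rightarrow> complex \<Rightarrow> complex ^ 5" where
  "curve_vec d t = vec5 1 t (t\<^sup>2) (t ^ 3) (t ^ d)"

definition apex :: "complex ^ 5" where
  "apex = vec5 0 0 0 0 1"

definition curve :: "nat \<Rightarrow> 5 proj set" where
  "curve d = insert (pt apex) (range (\<lambda>t. pt (curve_vec d t)))"

lemma curve_vec_nth [simp]:
  "curve_vec d t $ 0 = 1" "curve_vec d t $ 1 = t" "curve_vec d t $ 2 = t\<^sup>2"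
  "curve_vec d t $ 3 = t ^ 3" "curve_vec d t $ 4 = t ^ d"
  by (simp_all add: curve_vec_def)

lemma apex_nth [simp]: "apex $ 0 = 0" "apex $ 1 = 0" "apex $ 2 = 0" "apex $ 3 = 0" "apex $ 4 = 1"
  by (simp_all add: apex_def)

lemma curve_vec_nonzero [simp]: "curve_vec d t \<noteq> 0" and apex_nonzero [simp]: "apex \<noteq> 0"
  by (simp_all add: vec5_eq_iff)

lemma curve_image: "curve d = pt ` insert apex (range (curve_vec d))"
  by (auto simp: curve_def)

lemma pt_curve_vec_eq_iff [simp]: "pt (curve_vec d s) = pt (curve_vec d t) \<longleftrightarrow> s = t"
  by (auto simp: pt_eq_iff vec5_eq_iff)

lemma pt_curve_vec_neq_apex [simp]: "pt (curve_vec d s) \<noteq> pt apex" "pt apex \<noteq> pt (curve_vec d s)"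
  by (auto simp: pt_eq_iff vec5_eq_iff)

lemma curve_cases:
  assumes "p \<in> curve d"
  obtains (apex) "p = pt apex" | (param) t where "p = pt (curve_vec d t)"
  using assms by (auto simp: curve_def)

text \<open>The first three equations define the cone over the twisted cubic and the fourth fixes
  the last coordinate where \<open>x0 \<noteq> 0\<close>. The fifth is there for
  \<open>x0 = 0\<close>: it forces \<open>x3 = 0\<close>, so that only the apex remains.\<close>

definition curve_eqs :: "nat \<Rightarrow> 5 mpoly set" where
  "curve_eqs d = {coord 0 * coord 2 - coord 1 ^ 2, coord 0 * coord 3 - coord 1 * coord 2,
     coord 1 * coord 3 - coord 2 ^ 2, coord 4 * coord 0 ^ (d - 1) - coord 1 ^ d,
     coord 3 ^ d - coord 4 ^ 3 * coord 0 ^ (d - 3)}"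

lemma homogeneous_cong: "homogeneous j F \<Longrightarrow> j = k \<Longrightarrow> homogeneous k F"
  by simp

lemma homogeneous_curve_eqs:
  assumes "d \<ge> 4"
  shows "\<forall>F\<in>curve_eqs d. \<exists>k. homogeneous k F"
proof -
  note p1 = homogeneous_coord and pw = homogeneous_power[OF homogeneous_coord]
  note m = homogeneous_mult
  have "homogeneous 2 (coord 0 * coord 2 - coord 1 ^ 2 :: 5 mpoly)"
    by (rule homogeneous_diff; rule homogeneous_cong[OF m[OF p1 p1]] homogeneous_cong[OF pw])
      simp_all
  moreover have "homogeneous 2 (coord 0 * coord 3 - coord 1 * coord 2 :: 5 mpoly)"
    by (rule homogeneous_diff; rule homogeneous_cong[OF m[OF p1 p1]]) simp_all
  moreover have "homogeneous 2 (coord 1 * coord 3 - coord 2 ^ 2 :: 5 mpoly)"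
    by (rule homogeneous_diff; rule homogeneous_cong[OF m[OF p1 p1]] homogeneous_cong[OF pw])
      simp_all
  moreover have "homogeneous d (coord 4 * coord 0 ^ (d - 1) - coord 1 ^ d :: 5 mpoly)"
    by (rule homogeneous_diff; rule homogeneous_cong[OF m[OF p1 pw]] homogeneous_cong[OF pw])
      (use assms in simp_all)
  moreover have "homogeneous d (coord 3 ^ d - coord 4 ^ 3 * coord 0 ^ (d - 3) :: 5 mpoly)"
    by (rule homogeneous_diff; rule homogeneous_cong[OF m[OF pw pw]] homogeneous_cong[OF pw])
      (use assms in simp_all)
  ultimately show ?thesis unfolding curve_eqs_def by blast
qed

lemma curve_eq_proj_zeros:
  assumes "d \<ge> 4"
  shows "curve d = proj_zeros (curve_eqs d)"
proof -
  have iff: "pt v \<in> proj_zeros (curve_eqs d) \<longleftrightarrow> v $ 0 * v $ 2 = (v $ 1)\<^sup>2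
      \<and> v $ 0 * v $ 3 = v $ 1 * v $ 2
      \<and> v $ 1 * v $ 3 = (v $ 2)\<^sup>2 \<and> v $ 4 * v $ 0 ^ (d - 1) = v $ 1 ^ d
      \<and> v $ 3 ^ d = v $ 4 ^ 3 * v $ 0 ^ (d - 3)" if "v \<noteq> 0" for v
    unfolding pt_in_proj_zeros[OF homogeneous_curve_eqs[OF assms] that]
    by (simp add: curve_eqs_def peval_diff peval_mult peval_power)
  show ?thesis
  proof
    show "curve d \<subseteq> proj_zeros (curve_eqs d)"
    proof
      fix p assume "p \<in> curve d"
      then show "p \<in> proj_zeros (curve_eqs d)"
      proof (cases rule: curve_cases)
        case apex
        show ?thesis unfolding apex iff[OF apex_nonzero] using assms by (simp add: power_0_left)
      next
        case (param t)
        have "(t ^ 3) ^ d = (t ^ d) ^ 3" unfolding power_mult[symmetric]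
          by (simp only: mult.commute)
        moreover have "t ^ 3 = t * t\<^sup>2" "t * t ^ 3 = (t\<^sup>2)\<^sup>2" by (simp_all add: eval_nat_numeral)
        ultimately show ?thesis unfolding param iff[OF curve_vec_nonzero] curve_vec_nth
          by (simp only: mult_1 power_one mult_1_right simp_thms)
      qed
    qed
    show "proj_zeros (curve_eqs d) \<subseteq> curve d"
    proof
      fix p assume p: "p \<in> proj_zeros (curve_eqs d)"
      obtain v where v: "v \<noteq> 0" "p = pt v" by (rule pt_cases)
      note eqs = p[unfolded v(2) iff[OF v(1)]]
      show "p \<in> curve d"
      proof (cases "v $ 0 = 0")
        case True
        then have "v $ 1 = 0" using eqs by simp
        then have "v $ 2 = 0" using eqs by simp
        moreover have "v $ 3 = 0" using eqs True assms by (auto simp: power_0_left)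
        ultimately have "v = v $ 4 *s apex" using True \<open>v $ 1 = 0\<close> by (simp add: vec5_eq_iff)
        moreover from this have "v $ 4 \<noteq> 0" using v(1) by (metis vector_smult_lzero)
        ultimately have "p = pt apex" unfolding v(2) using v(1) by (subst pt_eq_iff) auto
        then show ?thesis by (simp add: curve_def)
      next
        case False
        define t where "t = v $ 1 / v $ 0"
        have 1: "v $ 1 = v $ 0 * t" using False by (simp add: t_def)
        have 2: "v $ 2 = v $ 0 * t\<^sup>2"
          using eqs False by (simp add: t_def field_simps power2_eq_square)
        have 3: "v $ 3 = v $ 0 * t ^ 3"
          using eqs 1 2 False by (simp add: power2_eq_square power3_eq_cube)
        have "v $ 0 ^ (d - 1) * v $ 4 = (v $ 0 * t) ^ d" using eqs 1 by (simp only: mult.commute)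
        also have "\<dots> = v $ 0 ^ d * t ^ d" by (rule power_mult_distrib)
        also have "v $ 0 ^ d = v $ 0 ^ (d - 1) * v $ 0" using assms power_minus_mult[of d "v $ 0"]
          by simp
        finally have "v $ 0 ^ (d - 1) * v $ 4 = v $ 0 ^ (d - 1) * (v $ 0 * t ^ d)"
          by (simp only: mult.assoc)
        then have 4: "v $ 4 = v $ 0 * t ^ d" using False by simp
        have "v = v $ 0 *s curve_vec d t" using 1 2 3 4 by (simp add: vec5_eq_iff)
        then have "p = pt (curve_vec d t)" unfolding v(2) using v(1) False by (subst pt_eq_iff) auto
        then show ?thesis by (simp add: curve_def)
      qed
    qed
  qed
qed

lemma closed_subset_curve:
  assumes "d \<ge> 4" "closedin zariski Z" "Z \<subseteq> curve d"
  shows "Z = curve d \<or> finite Z"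
proof -
  \<comment> \<open>The chart at infinity: \<open>curve_vec\<close> at \<open>1 / s\<close>,
    multiplied by \<open>s ^ d\<close>.\<close>
  define g where "g = (\<lambda>s::complex. vec5 (s ^ d) (s ^ (d - 1)) (s ^ (d - 2)) (s ^ (d - 3)) 1)"
  have g0: "g 0 = apex" using assms(1) by (simp add: g_def vec5_eq_iff power_0_left)
  have 1: "\<exists>p. \<forall>t. curve_vec d t $ i = poly p t" for i
    using exhaust_5[of i]
    by (elim disjE; simp)
      (rule exI[of _ 1] exI[of _ "[:0, 1:]"] exI[of _ "monom 1 2"] exI[of _ "monom 1 3"] exI[of _
        "monom 1 d"];
       simp add: poly_monom; fail)+
  have 2: "\<exists>p. \<forall>t. g t $ i = poly p t" for i
    using exhaust_5[of i]
    by (elim disjE; simp add: g_def)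
      (rule exI[of _ 1] exI[of _ "monom 1 d"] exI[of _ "monom 1 (d-1)"] exI[of _
        "monom 1 (d-2)"] exI[of _ "monom 1 (d-3)"];
       simp add: poly_monom; fail)+
  have 3: "pt (curve_vec d t) = pt (g (1 / t))" if "t \<noteq> 0" for t
  proof -
    have "curve_vec d t = t ^ d *s g (1 / t)"
      using that assms(1) by (simp add: vec5_eq_iff g_def power_diff field_simps)
    then show ?thesis using that by (simp add: pt_scale)
  qed
  have 4: "g t \<noteq> 0" for t by (simp add: g_def vec5_eq_iff)
  show ?thesis
    using closed_subset_param[of "curve_vec d" g Z, OF 1 curve_vec_nonzero 2 4 3 assms(2)] assms(3)
    unfolding g0 curve_def by blast
qed

lemma infinite_curve: "infinite (curve d)"
proof -
  have "inj (\<lambda>t. pt (curve_vec d t))" by (auto intro: injI)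
  then have "infinite (range (\<lambda>t. pt (curve_vec d t)))"
    using finite_imageD infinite_UNIV_char_0 by blast
  then show ?thesis by (simp add: curve_def)
qed

lemma closedin_curve: "d \<ge> 4 \<Longrightarrow> closedin zariski (curve d)"
  by (simp add: curve_eq_proj_zeros closedin_proj_zeros homogeneous_curve_eqs)

lemma projective_curve_curve: "d \<ge> 4 \<Longrightarrow> projective_curve (curve d)"
  using projective_curveI closedin_curve infinite_curve closed_subset_curve by metis

section \<open>Rank at most three off the tangent line\<close>

lemma in_span_3:
  fixes v x y z :: "complex ^ 'n"
  shows "a *s x + b *s y + c *s z \<in> vec.span {x, y, z}"
  by (intro vec.span_add vec.span_scale vec.span_base) auto

lemma X_rank_le:
  assumes "v \<noteq> 0" "0 \<notin> set ws" "pt ` set ws \<subseteq> X" "v \<in> vec.span (set ws)"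
  shows "X_rank X (pt v) \<le> length ws"
  unfolding X_rank_def
proof (rule Least_le, intro exI[of _ "map pt ws"] conjI)
  show "pt v \<in> proj_span (set (map pt ws))"
    using pt_in_proj_span[OF assms(1,2)] assms(4) by simp
qed (use assms(3) in auto)

lemma X_rank_curve_le_3:
  assumes "d \<ge> 5" "\<not> (v $ 0 = 0 \<and> v $ 1 = 0 \<and> v $ 2 = 0)"
  shows "X_rank (curve d) (pt v) \<le> 3"
proof -
  define a :: "nat \<Rightarrow> complex" where "a = (\<lambda>k. if k = 0 then v $ 0 else if k = 1 then v $ 1
    else if k = 2 then v $ 2 else v $ 3)"
  have a: "a 0 = v $ 0" "a 1 = v $ 1" "a 2 = v $ 2" "a 3 = v $ 3" by (simp_all add: a_def)
  have v0: "v \<noteq> 0" using assms(2) by auto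
  consider "two_secant a" | "three_secant d a (v $ 4)"
    using secant_cases[OF assms(1), of a "v $ 4"] assms(2) a by auto
  then have "\<exists>x y z. {x, y, z} \<subseteq> insert apex (range (curve_vec d)) \<and> v \<in> vec.span {x, y, z}"
  proof cases
    case 1
    then obtain x y c1 c2 where "\<forall>k<4. a k = c1 * x ^ k + c2 * y ^ k"
      unfolding two_secant_def by blast
    then have "v = c1 *s curve_vec d x + c2 *s curve_vec d y + (v $ 4 - c1 * x ^ d
      - c2 * y ^ d) *s apex"
      unfolding all_less_4 a by (simp add: vec5_eq_iff)
    then show ?thesis
      using in_span_3 by (metis empty_subsetI insertI1 insertI2 insert_subset rangeI)
  next
    case 2
    then obtain x y z c1 c2 c3 where "\<forall>k<4. a k = c1 * x ^ k + c2 * y ^ k + c3 * z ^ k"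
      "v $ 4 = c1 * x ^ d + c2 * y ^ d + c3 * z ^ d"
      unfolding three_secant_def by blast
    then have "v = c1 *s curve_vec d x + c2 *s curve_vec d y + c3 *s curve_vec d z"
      unfolding all_less_4 a by (simp add: vec5_eq_iff)
    then show ?thesis
      using in_span_3 by (metis empty_subsetI insertI2 insert_subset rangeI)
  qed
  then obtain x y z where xyz: "{x, y, z} \<subseteq> insert apex (range (curve_vec d))"
    "v \<in> vec.span {x, y, z}"
    by blast
  have "X_rank (curve d) (pt v) \<le> length [x, y, z]"
  proof (rule X_rank_le[OF v0])
    show "0 \<notin> set [x, y, z]"
      using xyz(1) curve_vec_nonzero apex_nonzero by (auto simp del: curve_vec_nonzero apex_nonzero)
    show "pt ` set [x, y, z] \<subseteq> curve d" using xyz(1) unfolding curve_image by auto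
  qed (use xyz(2) in simp)
  then show ?thesis by simp
qed

section \<open>Rank loci\<close>

lemma nondegenerate_curve: "nondegenerate (curve d)"
proof -
  have "p \<in> proj_span (curve d)" for p
  proof -
    obtain v where v: "v \<noteq> 0" "p = pt v" by (rule pt_cases)
    \<comment> \<open>The weights invert the Vandermonde system at the nodes 0, 1, -1, 2; the apex
      then corrects the last coordinate.\<close>
    define c3 where "c3 = (v $ 3 - v $ 1) / 6"
    define c1 where "c1 = (v $ 2 + v $ 1 - 6 * c3) / 2"
    define c2 where "c2 = (v $ 2 - v $ 1 - 2 * c3) / 2"
    define c0 where "c0 = v $ 0 - c1 - c2 - c3"
    define e where "e = v $ 4 - (c0 * 0 ^ d + c1 * 1 ^ d + c2 * (-1) ^ d + c3 * 2 ^ d)"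
    have "v = c0 *s curve_vec d 0 + c1 *s curve_vec d 1 + c2 *s curve_vec d (-1)
        + c3 *s curve_vec d 2 + e *s apex"
      by (simp add: vec5_eq_iff e_def c0_def) (simp add: c1_def c2_def c3_def field_simps)
    also have "\<dots> \<in> vec.span (insert apex (range (curve_vec d)))"
      by (intro vec.span_add vec.span_scale vec.span_base) auto
    finally show ?thesis
      unfolding v(2) curve_image by (subst pt_in_proj_span) (use v(1) in auto)
  qed
  then show ?thesis by (auto simp: nondegenerate_def)
qed

text \<open>Written as an affine chart plus one point, the shape required by
  \<open>closed_subset_param\<close>.\<close>

definition apex_tangent :: "5 proj set" where
  "apex_tangent = insert (pt apex) (range (\<lambda>t. pt (vec5 0 0 0 1 t)))"

lemma apex_tangent_iff:
  assumes "v \<noteq> 0"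
  shows "pt v \<in> apex_tangent \<longleftrightarrow> v $ 0 = 0 \<and> v $ 1 = 0 \<and> v $ 2 = 0"
proof
  assume "pt v \<in> apex_tangent"
  then consider "pt v = pt apex" | t where "pt v = pt (vec5 0 0 0 1 t)"
    by (auto simp: apex_tangent_def)
  then show "v $ 0 = 0 \<and> v $ 1 = 0 \<and> v $ 2 = 0"
  proof cases
    case 1
    then show ?thesis using assms by (auto simp: pt_eq_iff)
  next
    case 2
    moreover have "vec5 0 0 0 1 t \<noteq> (0 :: complex ^ 5)" by (simp add: vec5_eq_iff)
    ultimately show ?thesis using assms by (auto simp: pt_eq_iff)
  qed
next
  assume v: "v $ 0 = 0 \<and> v $ 1 = 0 \<and> v $ 2 = 0"
  show "pt v \<in> apex_tangent"
  proof (cases "v $ 3 = 0")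
    case True
    then have "v = v $ 4 *s apex" using v by (simp add: vec5_eq_iff)
    moreover from this have "v $ 4 \<noteq> 0" using assms by (metis vector_smult_lzero)
    ultimately have "pt v = pt apex" using assms by (subst pt_eq_iff) auto
    then show ?thesis by (simp add: apex_tangent_def)
  next
    case False
    define t where "t = v $ 4 / v $ 3"
    have "v = v $ 3 *s vec5 0 0 0 1 t" using v False by (simp add: vec5_eq_iff t_def)
    then have "pt v = pt (vec5 0 0 0 1 t)" using False by (metis pt_scale)
    then show ?thesis by (simp add: apex_tangent_def)
  qed
qed

lemma closedin_apex_tangent: "closedin zariski apex_tangent"
proof -
  let ?S = "{coord 0, coord 1, coord 2} :: 5 mpoly set"
  have S: "\<forall>F\<in>?S. \<exists>k. homogeneous k F" using homogeneous_coord by blast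
  have "p \<in> apex_tangent \<longleftrightarrow> p \<in> proj_zeros ?S" for p
  proof -
    obtain v where v: "v \<noteq> 0" "p = pt v" by (rule pt_cases)
    show ?thesis unfolding v(2) apex_tangent_iff[OF v(1)] pt_in_proj_zeros[OF S v(1)] by simp
  qed
  then have "apex_tangent = proj_zeros ?S" by blast
  then show ?thesis using closedin_proj_zeros[OF S] by simp
qed

lemma closed_subset_apex_tangent:
  assumes "closedin zariski Z" "Z \<subseteq> apex_tangent"
  shows "Z = apex_tangent \<or> finite Z"
proof -
  have 1: "\<exists>p. \<forall>t::complex. vec5 0 0 0 1 t $ i = poly p t" for i
    using exhaust_5[of i]
    by (elim disjE; simp) (rule exI[of _ 0] exI[of _ 1] exI[of _ "[:0, 1:]"]; simp; fail)+
  have 2: "\<exists>p. \<forall>t::complex. vec5 0 0 0 t 1 $ i = poly p t" for i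
    using exhaust_5[of i]
    by (elim disjE; simp) (rule exI[of _ 0] exI[of _ 1] exI[of _ "[:0, 1:]"]; simp; fail)+
  have 3: "vec5 0 0 0 1 t \<noteq> (0 :: complex ^ 5)" "vec5 0 0 0 t 1 \<noteq> (0 :: complex ^ 5)" for t
    by (simp_all add: vec5_eq_iff)
  have 4: "pt (vec5 0 0 0 1 t) = pt (vec5 0 0 0 (1 / t) 1)" if "t \<noteq> 0" for t :: complex
  proof -
    have "vec5 0 0 0 1 t = t *s vec5 0 0 0 (1 / t) 1" using that by (simp add: vec5_eq_iff)
    then show ?thesis using that by (metis pt_scale)
  qed
  have "vec5 0 0 0 0 1 = apex" by (simp add: apex_def)
  then show ?thesis
    using closed_subset_param[of "vec5 0 0 0 1" "\<lambda>s. vec5 0 0 0 s 1" Z, OF 1 3(1) 2 3(2) 4 assms(1)]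
      assms(2)
    by (simp add: apex_tangent_def)
qed

lemma rank_locus_4_subset:
  assumes "d \<ge> 5"
  shows "rank_locus (curve d) 4 \<subseteq> apex_tangent"
  unfolding rank_locus_def
proof (rule closure_of_minimal[OF _ closedin_apex_tangent], clarify)
  fix p assume p: "X_rank (curve d) p = 4"
  obtain v where v: "v \<noteq> 0" "p = pt v" by (rule pt_cases)
  show "p \<in> apex_tangent"
    using X_rank_curve_le_3[OF assms, of v] p unfolding v(2) apex_tangent_iff[OF v(1)] by fastforce
qed

lemma zdim_rank_locus_4:
  assumes "d \<ge> 5"
  shows "zdim (rank_locus (curve d) 4) \<le> 1"
  by (rule zdim_le_1[OF _ rank_locus_4_subset[OF assms] closed_subset_apex_tangent])
    (simp add: rank_locus_def)

lemma span_pair: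
  assumes "v \<in> vec.span {x, y}"
  obtains a b where "v = a *s x + b *s y"
proof -
  obtain a where "v - a *s x \<in> vec.span {y}" using assms vec.span_breakdown_eq by blast
  then obtain b where "v - a *s x = b *s y" by (auto simp: vec.span_singleton)
  then show ?thesis using that[of a b] by (simp add: algebra_simps)
qed

lemma proj_span_pair:
  assumes "v \<noteq> 0" "x \<noteq> 0" "y \<noteq> 0" "pt v \<in> proj_span {pt x, pt y}"
  obtains a b where "v = a *s x + b *s y"
proof -
  have "pt v \<in> proj_span (pt ` {x, y})" using assms(4) by simp
  then have "v \<in> vec.span {x, y}" using assms by (subst (asm) pt_in_proj_span) auto
  then show ?thesis using that by (rule span_pair)
qed

section \<open>The join with the curve\<close>

definition cone_poly :: "5 mpoly" where
  "cone_poly = coord 0 * coord 2 - coord 1 * coord 1"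

lemma homogeneous_cone: "\<forall>F\<in>{cone_poly}. \<exists>k. homogeneous k F"
  unfolding cone_poly_def using homogeneous_diff[OF homogeneous_mult homogeneous_mult, OF
    homogeneous_coord homogeneous_coord homogeneous_coord homogeneous_coord]
  by blast

lemma cone_iff: "v \<noteq> 0 \<Longrightarrow> pt v \<in> proj_zeros {cone_poly} \<longleftrightarrow> v $ 0 * v $ 2 = v $ 1 * v $ 1"
  unfolding pt_in_proj_zeros[OF homogeneous_cone] by (simp add: cone_poly_def peval_diff peval_mult)

lemma proj_join_rank_locus_4:
  assumes "d \<ge> 5"
  shows "proj_join (rank_locus (curve d) 4) (curve d) \<noteq> UNIV"
proof -
  have "proj_join (rank_locus (curve d) 4) (curve d) \<subseteq> proj_zeros {cone_poly}"
    unfolding proj_join_def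
  proof (rule closure_of_minimal[OF _ closedin_proj_zeros[OF homogeneous_cone]], clarify)
    fix w x p
    assume wx: "w \<in> rank_locus (curve d) 4" "x \<in> curve d" "p \<in> proj_span {w, x}"
    obtain v where v: "v \<noteq> 0" "p = pt v" by (rule pt_cases)
    obtain w' where w: "w' \<noteq> 0" "w = pt w'" by (rule pt_cases)
    obtain x' where x: "x' \<in> insert apex (range (curve_vec d))" "x = pt x'"
      using wx(2) by (auto simp: curve_image)
    have "x' \<noteq> 0" using x(1) by auto
    then obtain a b where ab: "v = a *s w' + b *s x'"
      using proj_span_pair[OF v(1) w(1), of x'] wx(3) v w x by blast
    have "w' $ 0 = 0" "w' $ 1 = 0" "w' $ 2 = 0"
      using rank_locus_4_subset[OF assms] wx(1) apex_tangent_iff[OF w(1)] w(2) by auto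
    \<comment> \<open>The first three coordinates of \<open>v\<close> are a multiple of those of
      \<open>x'\<close>, which are zero or of the form 1, t, t^2.\<close>
    then have "v $ 0 * v $ 2 = v $ 1 * v $ 1"
      using x(1) by (auto simp: ab power2_eq_square)
    then show "p \<in> proj_zeros {cone_poly}" unfolding v(2) cone_iff[OF v(1)] .
  qed
  moreover have "pt (vec5 1 0 1 0 0) \<notin> proj_zeros {cone_poly}"
    by (subst cone_iff) (simp_all add: vec5_eq_iff)
  ultimately show ?thesis by blast
qed

section \<open>Points of rank three and their density\<close>

text \<open>Projection from the apex shows that these points have rank exactly 3, since a point of space
  off the twisted cubic lies on at most one of its secants.\<close>

definition secant_apex :: "nat \<Rightarrow> 5 proj set" where
  "secant_apex d = {pt (c1 *s curve_vec d s + c2 *s curve_vec d t + c3 *s apex) | c1 c2 c3 s t.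
     s \<noteq> t \<and> c1 \<noteq> 0 \<and> c2 \<noteq> 0 \<and> c3 \<noteq> 0}"

lemma secant_vec_nonzero:
  assumes "s \<noteq> t" "c1 \<noteq> 0"
  shows "c1 *s curve_vec d s + c2 *s curve_vec d t + c3 *s apex \<noteq> 0"
proof
  assume *: "c1 *s curve_vec d s + c2 *s curve_vec d t + c3 *s apex = 0"
  then have "c1 + c2 = 0" "c1 * s + c2 * t = 0" by (simp_all add: vec5_eq_iff)
  then have "c1 * (s - t) = 0" by (simp add: algebra_simps add_eq_0_iff2)
  then show False using assms by simp
qed

text \<open>The cubic with roots \<open>x\<close>, \<open>y\<close> and one of \<open>s\<close>,
  \<open>t\<close> annihilates the right-hand side and one summand on the left. Hence it vanishes at
  the remaining node, which must be \<open>x\<close> or \<open>y\<close>.\<close>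

lemma secant_unique:
  fixes s t x y :: complex
  assumes "s \<noteq> t" "c1 \<noteq> 0" "c2 \<noteq> 0" "\<forall>k<4. c1 * s ^ k + c2 * t ^ k = a * x ^ k + b * y ^ k"
  shows "(x = s \<and> y = t \<and> a = c1 \<and> b = c2) \<or> (x = t \<and> y = s \<and> a = c2 \<and> b = c1)"
proof -
  have e: "c1 + c2 = a + b" "c1 * s + c2 * t = a * x + b * y"
    "c1 * s\<^sup>2 + c2 * t\<^sup>2 = a * x\<^sup>2 + b * y\<^sup>2" "c1 * s ^ 3 + c2 * t ^ 3 = a * x ^ 3 + b * y ^ 3"
    using assms(4) unfolding all_less_4 by simp_all
  have *: "(u - x) * (u - y) * (u - w) * c = 0"
    if h: "c + c' = a + b" "c * u + c' * w = a * x + b * y"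
      "c * u\<^sup>2 + c' * w\<^sup>2 = a * x\<^sup>2 + b * y\<^sup>2" "c * u ^ 3 + c' * w ^ 3 = a * x ^ 3 + b * y ^ 3"
    for u w c c'
  proof -
    have "(u - x) * (u - y) * (u - w) * c = (c * u ^ 3 + c' * w ^ 3) - (x + y + w) * (c * u\<^sup>2
      + c' * w\<^sup>2)
        + (x * y + y * w + x * w) * (c * u + c' * w) - x * y * w * (c + c')"
      by (simp add: algebra_simps eval_nat_numeral)
    also have "\<dots> = 0" unfolding h by (simp add: algebra_simps eval_nat_numeral)
    finally show ?thesis .
  qed
  have 1: "s = x \<or> s = y" using *[of c1 c2 s t] e assms(1,2) by auto
  have 2: "t = x \<or> t = y" using *[of c2 c1 t s] e assms(1,3) by (auto simp: add.commute)
  have **: "c1 = a' \<and> c2 = b'" if "c1 + c2 = a' + b'" "c1 * s + c2 * t = a' * s + b' * t" for a' b'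
  proof -
    have "(c1 - a') * (s - t) = (c1 * s + c2 * t) - (c1 + c2) * t -
      ((a' * s + b' * t) - (a' + b') * t)"
      by (simp add: algebra_simps)
    then have "(c1 - a') * (s - t) = 0" unfolding that by simp
    then show ?thesis using that(1) assms(1) by simp
  qed
  from 1 2 assms(1) consider "s = x" "t = y" | "s = y" "t = x" by blast
  then show ?thesis
  proof cases
    case 1
    then show ?thesis using **[of a b] e by simp
  next
    case 2
    then show ?thesis using **[of b a] e by (simp add: add.commute)
  qed
qed

lemma X_rank_secant_apex:
  assumes "p \<in> secant_apex d"
  shows "X_rank (curve d) p = 3" "p \<in> (\<Union>ps\<in>{ps. length ps = 3
    \<and> set ps \<subseteq> curve d}. proj_span (set ps))"
proof -
  obtain c1 c2 c3 s t where st: "s \<noteq> t" "c1 \<noteq> 0" "c2 \<noteq> 0" "c3 \<noteq> 0"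
    and p: "p = pt (c1 *s curve_vec d s + c2 *s curve_vec d t + c3 *s apex)"
    using assms unfolding secant_apex_def by blast
  define v where "v = c1 *s curve_vec d s + c2 *s curve_vec d t + c3 *s apex"
  have v: "v \<noteq> 0" using secant_vec_nonzero[OF st(1,2)] by (simp add: v_def)
  have p: "p = pt v" using p v_def by simp
  let ?P = "\<lambda>r. \<exists>ps. length ps = r \<and> set ps \<subseteq> curve d \<and> p \<in> proj_span (set ps)"
  define ps where "ps = map pt [curve_vec d s, curve_vec d t, apex]"
  have ps: "length ps = 3" "set ps \<subseteq> curve d" by (simp_all add: ps_def curve_def)
  have "pt v \<in> proj_span (pt ` {curve_vec d s, curve_vec d t, apex})"
    using v in_span_3[of c1 "curve_vec d s" c2 "curve_vec d t" c3 apex]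
    by (subst pt_in_proj_span) (auto simp: v_def)
  then have pps: "p \<in> proj_span (set ps)" by (simp add: ps_def p)
  then show "p \<in> (\<Union>ps\<in>{ps. length ps = 3 \<and> set ps \<subseteq> curve d}. proj_span (set ps))"
    using ps by blast
  have "\<not> ?P r" if r: "r < 3" for r
  proof
    assume "?P r"
    then obtain qs where qs: "length qs = r" "set qs \<subseteq> curve d" "p \<in> proj_span (set qs)" by blast
    \<comment> \<open>Shorter lists are padded, so that only pairs need to be excluded.\<close>
    have "\<exists>x\<in>curve d. \<exists>y\<in>curve d. set qs \<subseteq> {x, y}"
    proof -
      have a: "pt apex \<in> curve d" by (simp add: curve_def)
      consider "qs = []" | x where "qs = [x]" | x y where "qs = [x, y]"
        using qs(1) r by (cases qs rule: remdups_adj.cases) auto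
      then show ?thesis using a qs(2) by cases auto
    qed
    then obtain x y where xy: "x \<in> curve d" "y \<in> curve d" "set qs \<subseteq> {x, y}" by blast
    have "p \<in> proj_span {x, y}"
      using qs(3) xy(3) vec.span_mono[of "\<Union>q\<in>set qs. line_of q" "\<Union>q\<in>{x, y}. line_of q"]
      unfolding proj_span_def by blast
    moreover obtain x' y' where x': "x = pt x'" "x' \<in> insert apex (range (curve_vec d))"
      and y': "y = pt y'" "y' \<in> insert apex (range (curve_vec d))"
      using xy unfolding curve_image by blast
    moreover have "x' \<noteq> 0" "y' \<noteq> 0" using x' y' by auto
    ultimately obtain a b where ab: "v = a *s x' + b *s y'"
      using proj_span_pair[OF v] p by metis
    \<comment> \<open>A switch \<open>e\<close> treats both kinds of points alike:
      \<open>e = 1\<close> for a parameter point, \<open>e = 0\<close> for the apex.\<close>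
    have *: "\<exists>e f x. (e = 1 \<and> f = x ^ d \<or> e = 0) \<and> z = vec5 e (e * x) (e * x\<^sup>2) (e * x ^ 3) f"
      if "z \<in> insert apex (range (curve_vec d))" for z
      using that by (auto simp: vec5_eq_iff intro: exI[of _ 0])
    obtain e f x where x1: "e = 1 \<and> f = x ^ d \<or> e = 0" "x' = vec5 e (e * x) (e * x\<^sup>2) (e * x ^ 3) f"
      using *[OF x'(2)] by blast
    obtain e' f' y where y1: "e' = 1 \<and> f' = y ^ d \<or> e' = 0"
      "y' = vec5 e' (e' * y) (e' * y\<^sup>2) (e' * y ^ 3) f'"
      using *[OF y'(2)] by blast
    have eq: "c1 * s ^ d + c2 * t ^ d + c3 = a * f + b * f'"
      "\<forall>k<4. c1 * s ^ k + c2 * t ^ k = (a * e) * x ^ k + (b * e') * y ^ k"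
      using ab unfolding v_def x1 y1 all_less_4 by (simp_all add: vec5_eq_iff)
    \<comment> \<open>The weights \<open>a * e\<close> and \<open>b * e'\<close> equal
      \<open>c1\<close> and \<open>c2\<close> in some order, so both switches are 1; the last
      coordinate then yields \<open>c3 = 0\<close>.\<close>
    from secant_unique[OF st(1-3) eq(2)] show False
      using eq(1) st x1(1) y1(1) by (elim disjE) auto
  qed
  moreover have "?P 3" using ps pps by blast
  ultimately show "X_rank (curve d) p = 3"
    unfolding X_rank_def by (intro Least_equality) (auto simp: not_less[symmetric])
qed

text \<open>The leading coefficient times the discriminant of the quadratic form apolar to the first four
  coordinates; where it does not vanish, these lie on a proper secant of the twisted cubic.\<close>

definition hankel_poly :: "5 mpoly" where
  "hankel_poly = cone_poly * ((coord 1 * coord 2 - coord 0 * coord 3) ^ 2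
     - 4 * (coord 1 * coord 3 - coord 2 ^ 2) * cone_poly)"

lemma peval_numeral: "peval (numeral k) v = numeral k"
  using peval_single[of 0 "numeral k" v] by simp

lemma peval_hankel_poly:
  "peval hankel_poly v = (v $ 0 * v $ 2 - (v $ 1)\<^sup>2) *
     ((v $ 1 * v $ 2 - v $ 0 * v $ 3)\<^sup>2 - 4 * (v $ 1 * v $ 3 - (v $ 2)\<^sup>2)
       * (v $ 0 * v $ 2 - (v $ 1)\<^sup>2))"
  by (simp add: hankel_poly_def cone_poly_def peval_diff peval_mult peval_power peval_numeral
    power2_eq_square)

text \<open>The discriminant is \<open>q2^2 * (x - y)^2\<close> and
  \<open>q2 = c1 * c2 * (x - y)^2\<close>, so the two factors of \<open>hankel_poly\<close> give
  distinct nodes and nonzero weights.\<close>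

lemma hankel_secant:
  assumes "peval hankel_poly v \<noteq> 0"
  obtains x y c1 c2 where "x \<noteq> y" "c1 \<noteq> 0" "c2 \<noteq> 0"
    "v = c1 *s curve_vec d x + c2 *s curve_vec d y + (v $ 4 - c1 * x ^ d - c2 * y ^ d) *s apex"
proof -
  define a :: "nat \<Rightarrow> complex" where "a = (\<lambda>k. if k = 0 then v $ 0 else if k = 1 then v $ 1
    else if k = 2 then v $ 2 else v $ 3)"
  have a: "a 0 = v $ 0" "a 1 = v $ 1" "a 2 = v $ 2" "a 3 = v $ 3" by (simp_all add: a_def)
  define q0 q1 q2 where "q0 = a 1 * a 3 - (a 2)\<^sup>2" and "q1 = a 1 * a 2 - a 0 * a 3"
    and "q2 = a 0 * a 2 - (a 1)\<^sup>2"
  have q: "q2 \<noteq> 0" "q1\<^sup>2 - 4 * q0 * q2 \<noteq> 0"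
    using assms unfolding peval_hankel_poly q0_def q1_def q2_def a by auto
  have apolar: "q0 * a 0 + q1 * a 1 + q2 * a 2 = 0" "q0 * a 1 + q1 * a 2 + q2 * a 3 = 0"
    by (simp_all add: q0_def q1_def q2_def algebra_simps power2_eq_square)
  obtain x y where r: "- q1 = (x + y) * q2" "q0 = x * y * q2"
    "a 2 = (x + y) * a 1 - x * y * a 0" "a 3 = (x + y) * a 2 - x * y * a 1"
    using apolar_roots[OF q(1) apolar] by metis
  have "x \<noteq> y"
  proof
    assume "x = y"
    then have "(- q1)\<^sup>2 - 4 * q0 * q2 = 0"
      unfolding r(1,2) by (simp add: power2_eq_square algebra_simps)
    then show False using q(2) by simp
  qed
  then obtain c1 c2 where c: "\<forall>k<4. a k = c1 * x ^ k + c2 * y ^ k"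
    using two_secant_of_roots[OF _ r(3,4)] by blast
  then have e: "v $ 0 = c1 + c2" "v $ 1 = c1 * x + c2 * y" "v $ 2 = c1 * x\<^sup>2 + c2 * y\<^sup>2"
    "v $ 3 = c1 * x ^ 3 + c2 * y ^ 3" unfolding all_less_4 a by simp_all
  have "q2 = c1 * c2 * (x - y)\<^sup>2"
    unfolding q2_def a e by (simp add: algebra_simps power2_eq_square)
  then have "c1 \<noteq> 0" "c2 \<noteq> 0" using q(1) by auto
  moreover have "v = c1 *s curve_vec d x + c2 *s curve_vec d y + (v $ 4 - c1 * x ^ d
    - c2 * y ^ d) *s apex"
    using e by (simp add: vec5_eq_iff)
  ultimately show ?thesis using that \<open>x \<noteq> y\<close> by blast
qed

lemma poly_eq_0_cofinite:
  fixes P Q :: "'a::{idom,ring_char_0} poly"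
  assumes "Q \<noteq> 0" "\<And>x. poly Q x \<noteq> 0 \<Longrightarrow> poly P x = 0"
  shows "P = 0"
proof -
  have "poly (P * Q) x = 0" for x using assms(2)[of x] by auto
  then have "P * Q = 0" using poly_all_0_iff_0 by blast
  then show ?thesis using assms(1) by simp
qed

text \<open>A form vanishing on \<open>secant_apex\<close> is shown to vanish everywhere by
  restricting it to lines: first in the direction of the apex, to admit \<open>c3 = 0\<close>, then
  from any vector to one where \<open>hankel_poly\<close> is nonzero.\<close>

lemma closure_secant_apex: "zariski closure_of (secant_apex d) = UNIV"
proof -
  obtain S where S: "\<forall>F\<in>S. \<exists>k. homogeneous k F" "zariski closure_of (secant_apex d) = proj_zeros S"
    using closedin_closure_of[of zariski "secant_apex d"]
    unfolding closedin_zariski algebraic_set_def by blast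
  have sub: "secant_apex d \<subseteq> proj_zeros S"
    unfolding S(2)[symmetric] by (rule closure_of_subset) simp
  have "peval F v = 0" if F: "F \<in> S" for F v
  proof -
    have 1: "peval F (c1 *s curve_vec d s + c2 *s curve_vec d t + c *s apex) = 0"
      if st: "s \<noteq> t" "c1 \<noteq> 0" "c2 \<noteq> 0" for c1 c2 s t c
    proof -
      let ?f = "\<lambda>c. c1 *s curve_vec d s + c2 *s curve_vec d t + c *s apex"
      have "\<exists>p. \<forall>c. ?f c $ i = poly p c" for i
        by (rule exI[of _ "[:(c1 *s curve_vec d s + c2 *s curve_vec d t) $ i, apex $ i:]"]) simp
      then obtain P where P: "\<And>c. peval F (?f c) = poly P c" using peval_poly[of ?f F] by metis
      have z: "poly P c = 0" if "poly [:0, 1:] c \<noteq> 0" for c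
      proof -
        have "c \<noteq> 0" using that by simp
        then have "pt (?f c) \<in> secant_apex d" using st unfolding secant_apex_def by blast
        then have "pt (?f c) \<in> proj_zeros S" using sub by blast
        then have "peval F (?f c) = 0"
          using pt_in_proj_zeros[OF S(1) secant_vec_nonzero[OF st(1,2)]] F by blast
        then show ?thesis using P by simp
      qed
      have "P = 0" by (rule poly_eq_0_cofinite[of "[:0, 1:]", OF _ z]) simp_all
      then show ?thesis using P by simp
    qed
    have 2: "peval F w = 0" if "peval hankel_poly w \<noteq> 0" for w
      using hankel_secant[OF that, of d] 1 by metis
    \<comment> \<open>Its first four coordinates are those of the sum of the curve vectors at 1 and
      -1, hence on a proper secant.\<close>
    let ?w = "vec5 2 0 2 0 0 :: complex ^ 5"
    let ?f = "\<lambda>t. (1 - t) *s v + t *s ?w"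
    have "\<exists>p. \<forall>t. ?f t $ i = poly p t" for i
      by (rule exI[of _ "[:v $ i, ?w $ i - v $ i:]"]) (simp add: algebra_simps)
    then obtain P Q where P: "\<And>t. peval F (?f t) = poly P t"
      and Q: "\<And>t. peval hankel_poly (?f t) = poly Q t"
      using peval_poly[of ?f F] peval_poly[of ?f hankel_poly] by metis
    have "poly Q 1 \<noteq> 0" unfolding Q[symmetric] by (simp add: peval_hankel_poly)
    then have "Q \<noteq> 0" by auto
    then have "P = 0" using 2 P Q poly_eq_0_cofinite by metis
    then show "peval F v = 0" using P[of 0] by simp
  qed
  then have "pt v \<in> proj_zeros S" if "v \<noteq> 0" for v
    unfolding pt_in_proj_zeros[OF S(1) that] by blast
  then show ?thesis using S(2) pt_cases by (metis UNIV_eq_I)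
qed

lemma rank_locus_3: "rank_locus (curve d) 3 = UNIV"
  unfolding rank_locus_def
  using closure_of_mono[of "secant_apex d" "{p. X_rank (curve d) p = 3}" zariski]
    X_rank_secant_apex(1) closure_secant_apex by fastforce

lemma secant_variety_3: "secant_variety 3 (curve d) = UNIV"
proof -
  have "secant_apex d \<subseteq> (\<Union>ps\<in>{ps. length ps = 3 \<and> set ps \<subseteq> curve d}. proj_span (set ps))"
    using X_rank_secant_apex(2) by blast
  from closure_of_mono[OF this, of zariski] show ?thesis
    unfolding secant_variety_def closure_secant_apex by blast
qed

section \<open>Rationality\<close>

definition line_vec :: "complex \<Rightarrow> complex ^ 2" where
  "line_vec t = (\<chi> i. if i = 1 then 1 else t)"

lemma line_vec_nth [simp]: "line_vec t $ 1 = 1" "line_vec t $ 2 = t"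
  by (simp_all add: line_vec_def)

lemma line_vec_nonzero [simp]: "line_vec t \<noteq> 0"
  by (simp add: vec_eq_iff forall_2)

lemma pt_line_vec_eq_iff [simp]: "pt (line_vec s) = pt (line_vec t) \<longleftrightarrow> s = t"
  by (auto simp: pt_eq_iff vec_eq_iff forall_2)

lemma range_pt_line_vec: "range (\<lambda>t. pt (line_vec t)) = UNIV - {pt (\<chi> i. if i = 1 then 0 else 1)}"
proof -
  define e :: "complex ^ 2" where "e = (\<chi> i. if i = 1 then 0 else 1)"
  have e: "e $ 1 = 0" "e $ 2 = 1" by (simp_all add: e_def)
  then have e0: "e \<noteq> 0" by auto
  have "p \<in> range (\<lambda>t. pt (line_vec t)) \<longleftrightarrow> p \<noteq> pt e" for p
  proof -
    obtain v where v: "v \<noteq> 0" "p = pt v" by (rule pt_cases)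
    show ?thesis
    proof (cases "v $ 1 = 0")
      case True
      then have c: "v = v $ 2 *s e" by (simp add: vec_eq_iff forall_2 e)
      then have "v $ 2 \<noteq> 0" using v(1) by (metis vector_smult_lzero)
      then have "p = pt e" unfolding v(2) by (subst c, intro pt_scale)
      moreover have "pt e \<noteq> pt (line_vec t)" for t
        unfolding pt_eq_iff[OF e0 line_vec_nonzero] using e(1) by auto
      ultimately show ?thesis by blast
    next
      case False
      then have c: "v = v $ 1 *s line_vec (v $ 2 / v $ 1)" by (simp add: vec_eq_iff forall_2)
      have "pt v = pt (line_vec (v $ 2 / v $ 1))" by (subst c, intro pt_scale False)
      then have "p \<in> range (\<lambda>t. pt (line_vec t))" unfolding v(2) by (rule range_eqI)
      moreover have "pt v \<noteq> pt e" unfolding pt_eq_iff[OF v(1) e0] using e(1) False by auto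
      ultimately show ?thesis unfolding v(2) by blast
    qed
  qed
  then show ?thesis unfolding e_def by blast
qed

text \<open>One tuple of forms serves the whole domain, so the neighbourhood in
  \<open>regular_on\<close> is the domain itself; the factor \<open>c ^ k\<close> accounts for the
  choice of representative.\<close>

lemma regular_onI:
  fixes F :: "'n::finite \<Rightarrow> 'm::finite mpoly"
  assumes "\<And>i. homogeneous k (F i)" "\<And>t. w t \<noteq> 0" "\<And>t. z t \<noteq> 0"
    "\<And>t c. c \<noteq> 0 \<Longrightarrow> (\<chi> i. peval (F i) (c *s w t)) = c ^ k *s z t"
    "\<And>t. f (pt (w t)) = pt (z t)"
  shows "regular_on (range (\<lambda>t. pt (w t))) f"
  unfolding regular_on_def
proof (intro ballI exI conjI allI)
  let ?U = "range (\<lambda>t. pt (w t))"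
  fix p assume "p \<in> ?U"
  then show "p \<in> ?U" .
  show "openin (subtopology zariski ?U) ?U"
    by (metis openin_topspace topspace_subtopology_subset subset_UNIV topspace_zariski)
  show "homogeneous k (F i)" for i by (rule assms(1))
next
  fix q v assume "q \<in> range (\<lambda>t. pt (w t))" and v: "v \<in> line_of q - {0}"
  then obtain t where q: "q = pt (w t)" by blast
  have "v \<in> vec.span {w t}" using v by (simp add: q line_of_pt assms(2))
  then obtain c where c: "v = c *s w t" by (auto simp: vec.span_singleton)
  then have "c \<noteq> 0" using v by auto
  then have e: "(\<chi> i. peval (F i) v) = c ^ k *s z t" unfolding c by (rule assms(4))
  then show "(\<chi> i. peval (F i) v) \<noteq> 0" using \<open>c \<noteq> 0\<close> assms(3)[of t] by simp
  show "(\<chi> i. peval (F i) v) \<in> line_of (f q)"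
    unfolding e q assms(5) line_of_pt[OF assms(3)] by (intro vec.span_scale vec.span_base) simp
qed

lemma birational_curve:
  assumes "d \<ge> 4"
  shows "birational (curve d) (UNIV :: 2 proj set)"
proof -
  define f :: "5 proj \<Rightarrow> 2 proj" where "f = (\<lambda>p. pt (line_vec (THE t. p = pt (curve_vec d t))))"
  define g :: "2 proj \<Rightarrow> 5 proj" where "g = (\<lambda>q. pt (curve_vec d (THE t. q = pt (line_vec t))))"
  have f: "f (pt (curve_vec d t)) = pt (line_vec t)" for t by (simp add: f_def)
  have g: "g (pt (line_vec t)) = pt (curve_vec d t)" for t by (simp add: g_def)
  let ?U = "range (\<lambda>t. pt (curve_vec d t))" and ?V = "range (\<lambda>t. pt (line_vec t))"
  have op: "openin zariski (UNIV - {p})" for p :: "'n::finite proj"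
    using closedin_point[of p] by (simp add: closedin_def)
  have U: "openin (subtopology zariski (curve d)) ?U"
  proof -
    have "?U = (UNIV - {pt apex}) \<inter> curve d" by (auto simp: curve_def)
    then show ?thesis unfolding openin_subtopology using op by blast
  qed
  have V: "openin (subtopology zariski UNIV) ?V"
    unfolding range_pt_line_vec using op by (simp add: subtopology_UNIV)
  have "regular_on ?U f"
  proof (rule regular_onI[where k = 1 and F = "\<lambda>i::2. if i = 1 then coord 0 else coord 1" and z =
    line_vec])
    show "homogeneous 1 (if i = 1 then coord 0 else coord 1 :: 5 mpoly)" for i :: 2
      by (cases "i = 1") (simp_all only: if_True if_False refl homogeneous_coord)
    show "(\<chi> i::2. peval (if i = 1 then coord 0 else coord 1) (c *s curve_vec d t))
      = c ^ 1 *s line_vec t" for c t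
      by (simp add: vec_eq_iff forall_2)
  qed (simp_all add: f)
  moreover have "regular_on ?V g"
  \<comment> \<open>The entries of \<open>curve_vec\<close> homogenized in degree \<open>d\<close>,
    with coordinate 1 as homogenizing variable.\<close>
  proof (rule regular_onI[where k = d and z = "curve_vec d" and F =
    "\<lambda>i::5. if i = 0 then coord 1 ^ d
      else if i = 1 then coord 1 ^ (d - 1) * coord 2 ^ 1 else
        if i = 2 then coord 1 ^ (d - 2) * coord 2 ^ 2
      else if i = 3 then coord 1 ^ (d - 3) * coord 2 ^ 3 else coord 2 ^ d"])
    have 1: "homogeneous d (coord 1 ^ (d - j) * coord 2 ^ j :: 2 mpoly)" if "j \<le> d" for j
      by (rule homogeneous_cong[OF homogeneous_mult[OF homogeneous_power homogeneous_power, OF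
        homogeneous_coord homogeneous_coord]])
        (use that in simp)
    have 2: "homogeneous d (coord i ^ d :: 2 mpoly)" for i
      by (rule homogeneous_cong[OF homogeneous_power[OF homogeneous_coord]]) simp
    show "homogeneous d (if i = 0 then coord 1 ^ d
      else if i = 1 then coord 1 ^ (d - 1) * coord 2 ^ 1 else
        if i = 2 then coord 1 ^ (d - 2) * coord 2 ^ 2
      else if i = 3 then coord 1 ^ (d - 3) * coord 2 ^ 3 else coord 2 ^ d :: 2 mpoly)" for i :: 5
      using 1[of 1] 1[of 2] 1[of 3] 2 assms by (simp del: power_one_right)
    have 3: "c ^ d = c ^ (d - j) * c ^ j" if "j \<le> d" for j and c :: complex
      using that by (simp flip: power_add)
    show "(\<chi> i. peval (if i = 0 then coord 1 ^ d
      else if i = 1 then coord 1 ^ (d - 1) * coord 2 ^ 1 else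
        if i = 2 then coord 1 ^ (d - 2) * coord 2 ^ 2
      else if i = 3 then coord 1 ^ (d - 3) * coord 2 ^ 3 else coord 2 ^ d) (c *s line_vec t))
        = c ^ d *s curve_vec d t" for c t
      using 3[of 1 c] 3[of 2 c] 3[of 3 c] assms
      by (simp add: vec5_eq_iff peval_mult peval_power power_mult_distrib)
  qed (simp_all add: g)
  ultimately show ?thesis
    unfolding birational_def using U V f g
    by (intro exI[of _ ?U] exI[of _ ?V] exI[of _ f] exI[of _ g]) auto
qed

lemma rational_curve_curve: "d \<ge> 4 \<Longrightarrow> rational_curve (curve d)"
  by (simp add: rational_curve_def projective_curve_curve birational_curve)

section \<open>Degree\<close>

text \<open>The linear form \<open>h\<close> restricted to \<open>curve_vec\<close>: its roots are
  the parameters of the hyperplane section away from the apex.\<close>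

definition form_poly :: "nat \<Rightarrow> complex ^ 5 \<Rightarrow> complex poly" where
  "form_poly d h = [:h $ 0, h $ 1, h $ 2, h $ 3:] + monom (h $ 4) d"

definition form_coeff :: "nat \<Rightarrow> nat \<Rightarrow> 5 mpoly" where
  "form_coeff d k = (if k < 4 then coord (of_nat k) else if k = d then coord 4 else 0)"

lemma peval_form_coeff: "d \<ge> 4 \<Longrightarrow> peval (form_coeff d k) h = coeff (form_poly d h) k"
  by (auto simp: form_coeff_def form_poly_def coeff_pCons numeral_eq_Suc less_Suc_eq split:
    nat.split)

lemma homogeneous_zero: "homogeneous k 0"
  by (simp add: homogeneous_def)

lemma homogeneous_form_coeff: "homogeneous 1 (form_coeff d k)"
  unfolding form_coeff_def using homogeneous_coord homogeneous_zero
  by (auto simp del: One_nat_def intro: homogeneous_coord homogeneous_zero)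

text \<open>The entries are linear forms in the coefficients of the hyperplane, which makes the
  determinant a form on the dual space. \<open>sylvester_row\<close> is the same row as a polynomial
  in the parameter, for a given \<open>h\<close>.\<close>

definition sylvester_entry :: "nat \<Rightarrow> nat \<Rightarrow> nat \<Rightarrow> 5 mpoly" where
  "sylvester_entry d i j =
     (if i < d - 1
      then if i \<le> j then Poly_Mapping.single 0 (of_nat d - of_nat (j - i)) * form_coeff d (j - i)
        else 0
      else if i - (d - 1) \<le> j
      then Poly_Mapping.single 0 (of_nat (Suc (j - (i - (d - 1))))) * form_coeff d (Suc (j - (i - (d
        - 1))))
      else 0)"

lemma homogeneous_sylvester_entry: "homogeneous 1 (sylvester_entry d i j)"
  unfolding sylvester_entry_def
  by (auto simp del: One_nat_def intro: homogeneous_scale homogeneous_form_coeff homogeneous_zero)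

definition sylvester_row :: "nat \<Rightarrow> complex ^ 5 \<Rightarrow> nat \<Rightarrow> complex poly" where
  "sylvester_row d h i = (let f = form_poly d h in
     if i < d - 1 then monom 1 i * (Polynomial.smult (of_nat d) f - pCons 0 (pderiv f))
     else monom 1 (i - (d - 1)) * pderiv f)"

lemma peval_sylvester_entry:
  assumes "d \<ge> 4"
  shows "peval (sylvester_entry d i j) h = coeff (sylvester_row d h i) j"
proof -
  have "coeff (pCons 0 (pderiv p)) k = of_nat k * coeff p k" for p :: "complex poly" and k
    by (cases k) (simp_all add: coeff_pderiv)
  then show ?thesis
    using assms by (simp add: sylvester_entry_def sylvester_row_def Let_def peval_mult
      peval_form_coeff
      coeff_monom_mult coeff_pderiv left_diff_distrib del: mult_pCons_right)
qed

text \<open>The rows are shifts of \<open>d f - t f'\<close> and \<open>f'\<close>. For \<open>f = h\<^sub>0 + \<dots> + h\<^sub>3 t\<^sup>3 + h\<^sub>4 t\<^sup>d\<close> the former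
  has
  degree at most 3, so that the determinant, which vanishes whenever \<open>f\<close> has a double root, has
  size \<open>d + 2\<close>.\<close>

definition disc_poly :: "nat \<Rightarrow> 5 mpoly" where
  "disc_poly d = (\<Sum>p\<in>{p. p permutes {0..<d + 2}}.
     Poly_Mapping.single 0 (signof p) * (\<Prod>i = 0..<d + 2. sylvester_entry d i (p i)))"

lemma homogeneous_sum: "(\<And>i. i \<in> I \<Longrightarrow> homogeneous k (F i)) \<Longrightarrow> homogeneous k (sum F I)"
  by (induction I rule: infinite_finite_induct) (auto intro: homogeneous_add homogeneous_zero)

lemma homogeneous_prod: "finite I \<Longrightarrow> (\<And>i. i \<in> I \<Longrightarrow> homogeneous 1 (F i))
  \<Longrightarrow> homogeneous (card I) (prod F I)"
proof (induction I rule: finite_induct)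
  case empty
  then show ?case by (simp add: homogeneous_def)
next
  case (insert x I)
  then show ?case using homogeneous_mult[of 1 "F x" "card I" "prod F I"] by simp
qed

lemma peval_sum: "peval (sum F I) v = (\<Sum>i\<in>I. peval (F i) v)"
  by (induction I rule: infinite_finite_induct) (simp_all add: peval_add)

lemma peval_prod: "peval (prod F I) v = (\<Prod>i\<in>I. peval (F i) v)"
  by (induction I rule: infinite_finite_induct) (simp_all add: peval_mult)

lemma homogeneous_disc_poly: "homogeneous (d + 2) (disc_poly d)"
  unfolding disc_poly_def
  using homogeneous_prod[of "{0..<d + 2}"] homogeneous_sylvester_entry
  by (intro homogeneous_sum homogeneous_scale) fastforce

lemma peval_of_int: "peval (of_int k) v = of_int k"
  using peval_single[of 0 "of_int k" v] by simp

lemma peval_disc_poly: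
  assumes "d \<ge> 4"
  shows "peval (disc_poly d) h = Determinant.det (Matrix.mat (d + 2) (d
    + 2) (\<lambda>(i, j). coeff (sylvester_row d h i) j))"
proof -
  have "p i < d + 2" if "p permutes {0..<d + 2}" "i < d + 2" for p i
    using permutes_in_image[OF that(1), of i] that(2) by simp
  then show ?thesis
    unfolding disc_poly_def Determinant.det_def peval_sum peval_mult peval_prod
      peval_sylvester_entry[OF assms]
    by (auto simp: peval_of_int intro!: sum.cong prod.cong)
qed

text \<open>A double root \<open>t\<close> is a root of every row polynomial, so the vector of
  powers of \<open>t\<close> lies in the kernel of the matrix; its first entry is 1.\<close>

lemma disc_poly_double_root:
  assumes "d \<ge> 4" "poly (form_poly d h) t = 0" "poly (pderiv (form_poly d h)) t = 0"
  shows "peval (disc_poly d) h = 0"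
proof -
  let ?n = "d + 2"
  let ?M = "Matrix.mat ?n ?n (\<lambda>(i, j). coeff (sylvester_row d h i) j)"
  let ?v = "Matrix.vec ?n (\<lambda>j. t ^ j)"
  have M: "?M \<in> carrier_mat ?n ?n" by simp
  have deg: "degree (sylvester_row d h i) < ?n" if "i < ?n" for i
  proof -
    let ?f = "form_poly d h"
    have 1: "degree (Polynomial.smult (of_nat d) ?f - pCons 0 (pderiv ?f)) \<le> 3"
    proof (rule degree_le, intro allI impI)
      fix k :: nat assume "k > 3"
      then have "coeff ?f k = (if k = d then h $ 4 else 0)"
        by (auto simp: form_poly_def coeff_pCons split: nat.split)
      then show "coeff (Polynomial.smult (of_nat d) ?f - pCons 0 (pderiv ?f)) k = 0"
        using \<open>k > 3\<close> by (cases k) (auto simp: coeff_pderiv)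
    qed
    have "degree ?f \<le> d"
      unfolding form_poly_def using assms(1) by (intro degree_add_le degree_monom_le) simp
    then have 2: "degree (pderiv ?f) \<le> d - 1" by (simp add: degree_pderiv)
    show ?thesis
    proof (cases "i < d - 1")
      case True
      then have "degree (sylvester_row d h i) \<le> degree (monom 1 i :: complex poly)
          + degree (Polynomial.smult (of_nat d) ?f - pCons 0 (pderiv ?f))"
        by (simp add: sylvester_row_def Let_def degree_mult_le)
      then show ?thesis using 1 True by (simp add: degree_monom_eq)
    next
      case False
      then have "degree (sylvester_row d h i) \<le> degree (monom 1 (i - (d - 1)) :: complex poly)
        + degree (pderiv ?f)"
        by (simp add: sylvester_row_def Let_def degree_mult_le)
      then show ?thesis using 2 False that assms(1) by (simp add: degree_monom_eq)
    qed
  qed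
  have "?M *\<^sub>v ?v = 0\<^sub>v ?n"
  proof (rule eq_vecI)
    fix i assume "i < dim_vec (0\<^sub>v ?n :: complex Matrix.vec)"
    then have i: "i < ?n" by simp
    have "vec_index (?M *\<^sub>v ?v) i = (\<Sum>j<?n. coeff (sylvester_row d h i) j * t ^ j)"
      using i by (simp add: scalar_prod_def lessThan_atLeast0)
    also have "\<dots> = poly (sylvester_row d h i) t"
      unfolding poly_altdef using deg[OF i]
      by (intro sum.mono_neutral_right) (auto simp: coeff_eq_0)
    also have "\<dots> = 0"
      using assms(2,3) by (simp add: sylvester_row_def Let_def)
    finally show "vec_index (?M *\<^sub>v ?v) i = vec_index (0\<^sub>v ?n) i" using i by simp
  qed simp
  moreover have "?v \<in> carrier_vec ?n" by simp
  moreover have "?v \<noteq> 0\<^sub>v ?n"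
  proof
    assume "?v = 0\<^sub>v ?n"
    then have "vec_index ?v 0 = vec_index (0\<^sub>v ?n :: complex Matrix.vec) 0" by simp
    then show False by simp
  qed
  ultimately have "Determinant.det ?M = 0" using det_0_iff_vec_prod_zero_field[OF M] by blast
  then show ?thesis using peval_disc_poly[OF assms(1)] by simp
qed

text \<open>For \<open>f = 1 + t^d\<close> the two polynomials behind the rows are \<open>d\<close>
  and \<open>d * t^(d-1)\<close>, so the matrix is \<open>d\<close> times the identity.\<close>

lemma disc_poly_nonzero:
  assumes "d \<ge> 5"
  shows "peval (disc_poly d) (vec5 1 0 0 0 1) \<noteq> 0"
proof -
  let ?n = "d + 2" and ?h = "vec5 1 0 0 0 1 :: complex ^ 5"
  let ?M = "Matrix.mat ?n ?n (\<lambda>(i, j). coeff (sylvester_row d ?h i) j)"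
  have f: "form_poly d ?h = 1 + monom 1 d" by (simp add: form_poly_def one_pCons)
  have pd: "pderiv (form_poly d ?h) = monom (of_nat d) (d - 1)"
    unfolding f pderiv_add pderiv_1 pderiv_monom by simp
  have "pCons 0 (pderiv (form_poly d ?h)) = monom (of_nat d) d"
    unfolding pd using assms by (simp flip: monom_Suc)
  then have "Polynomial.smult (of_nat d) (form_poly d ?h) - pCons 0 (pderiv (form_poly d ?h))
    = [:of_nat d:]"
    by (simp add: f smult_add_right smult_monom)
  then have row: "sylvester_row d ?h i = monom (of_nat d) i" if "i < ?n" for i
    unfolding sylvester_row_def Let_def pd by (auto simp: mult_monom smult_monom)
  have M: "?M \<in> carrier_mat ?n ?n" by simp
  have "upper_triangular ?M" by (auto simp: row)
  then have "Determinant.det ?M = prod_list (diag_mat ?M)" using det_upper_triangular M by blast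
  also have "\<dots> \<noteq> 0" using assms by (auto simp: prod_list_zero_iff diag_mat_def row)
  finally show ?thesis using peval_disc_poly[of d] assms by simp
qed

lemma hyperplane_pt:
  assumes "h \<noteq> 0" "v \<noteq> 0"
  shows "pt v \<in> hyperplane (pt h) \<longleftrightarrow> (\<Sum>i\<in>UNIV. h $ i * v $ i) = 0"
proof -
  have scale: "(\<Sum>i\<in>UNIV. (a *s h) $ i * (b *s v) $ i) = a * b * (\<Sum>i\<in>UNIV. h $ i * v $ i)" for a b
    by (simp add: sum_distrib_left mult_ac)
  show ?thesis
  proof
    assume "pt v \<in> hyperplane (pt h)"
    moreover have "h \<in> line_of (pt h)" "v \<in> line_of (pt v)"
      using assms by (simp_all add: line_of_pt vec.span_base)
    ultimately show "(\<Sum>i\<in>UNIV. h $ i * v $ i) = 0"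
      unfolding hyperplane_def by blast
  next
    assume 0: "(\<Sum>i\<in>UNIV. h $ i * v $ i) = 0"
    show "pt v \<in> hyperplane (pt h)"
      unfolding hyperplane_def line_of_pt[OF assms(1)] line_of_pt[OF assms(2)] vec.span_singleton
        mem_Collect_eq
        ball_simps
      by (simp only: scale 0 mult_zero_right simp_thms)
  qed
qed

lemma degree_curve:
  assumes "d \<ge> 5"
  shows "curve_has_degree (curve d) d"
  unfolding curve_has_degree_def
proof (intro exI conjI ballI)
  \<comment> \<open>The factor \<open>coord 4\<close> keeps the apex off the hyperplane and the
    degree of the restricted form equal to \<open>d\<close>; the other factor makes its roots
    simple.\<close>
  let ?Z = "proj_zeros {disc_poly d * coord 4}"
  have S: "\<forall>F\<in>{disc_poly d * coord 4}. \<exists>k. homogeneous k F"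
    using homogeneous_mult[OF homogeneous_disc_poly homogeneous_coord] by blast
  show "openin zariski (- ?Z)"
    using closedin_proj_zeros[OF S] by (simp add: closedin_def Compl_eq_Diff_UNIV)
  have "pt (vec5 1 0 0 0 1) \<notin> ?Z"
    using disc_poly_nonzero[OF assms]
    by (subst pt_in_proj_zeros[OF S]) (simp_all add: vec5_eq_iff peval_mult)
  then show "- ?Z \<noteq> {}" by blast
  fix p assume p: "p \<in> - ?Z"
  obtain h where h: "h \<noteq> 0" "p = pt h" by (rule pt_cases)
  have "pt h \<notin> ?Z" using p h(2) by simp
  then have h4: "peval (disc_poly d) h \<noteq> 0" "h $ 4 \<noteq> 0"
    unfolding pt_in_proj_zeros[OF S h(1)] by (simp_all add: peval_mult)
  let ?f = "form_poly d h"
  have "rsquarefree ?f"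
    unfolding rsquarefree_roots using disc_poly_double_root[of d h] h4(1) assms by auto
  then have dec: "Polynomial.smult (lead_coeff ?f) (\<Prod>z|poly ?f z = 0. [:-z, 1:]) = ?f"
    by (rule complex_poly_decompose_rsquarefree)
  have deg: "degree ?f = d"
  proof (rule antisym)
    show "degree ?f \<le> d"
      unfolding form_poly_def using assms by (intro degree_add_le degree_monom_le) simp
    have "coeff ?f d \<noteq> 0" using h4(2) assms
      by (auto simp: form_poly_def coeff_pCons numeral_eq_Suc split: nat.split)
    then show "d \<le> degree ?f" by (rule le_degree)
  qed
  then have "?f \<noteq> 0" using assms by auto
  then have fin: "finite {t. poly ?f t = 0}" by (rule poly_roots_finite)
  have "d = degree (Polynomial.smult (lead_coeff ?f) (\<Prod>z|poly ?f z = 0. [:-z, 1:]))" using dec deg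
    by simp
  also have "\<dots> = card {t. poly ?f t = 0}"
    using \<open>?f \<noteq> 0\<close> by (simp add: degree_prod_eq_sum_degree)
  finally have card: "card {t. poly ?f t = 0} = d" by simp
  have "curve d \<inter> hyperplane p = (\<lambda>t. pt (curve_vec d t)) ` {t. poly ?f t = 0}"
  proof -
    have "pt apex \<notin> hyperplane p"
      unfolding h(2) hyperplane_pt[OF h(1) apex_nonzero] using h4(2) by (simp add: sum_5)
    moreover have "pt (curve_vec d t) \<in> hyperplane p \<longleftrightarrow> poly ?f t = 0" for t
      unfolding h(2) hyperplane_pt[OF h(1) curve_vec_nonzero]
      by (simp add: sum_5 form_poly_def poly_monom algebra_simps power2_eq_square power3_eq_cube)
    ultimately show ?thesis unfolding curve_def by blast
  qed
  moreover have "inj (\<lambda>t. pt (curve_vec d t))" by (auto intro: injI)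
  ultimately show "finite (curve d \<inter> hyperplane p)" "card (curve d \<inter> hyperplane p) = d"
    using fin card by (auto simp: card_image inj_on_subset)
qed

theorem theorem1p3:
  fixes d :: nat
  assumes "d \<ge> 5"
  shows "\<exists>X :: 5 proj set.
    rational_curve X \<and> nondegenerate X \<and> curve_has_degree X d \<and>
    zdim (rank_locus X 4) \<le> 1 \<and>
    proj_join (rank_locus X 4) X \<subset> rank_locus X 3 \<and>
    rank_locus X 3 = secant_variety 3 X \<and>
    secant_variety 3 X = UNIV"
proof (intro exI[of _ "curve d"] conjI)
  show "proj_join (rank_locus (curve d) 4) (curve d) \<subset> rank_locus (curve d) 3"
    using proj_join_rank_locus_4[OF assms] by (auto simp: rank_locus_3)
qed (use assms in \<open>simp_all add: rational_curve_curve nondegenerate_curve degree_curve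
  zdim_rank_locus_4 rank_locus_3 secant_variety_3\<close>)

end
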